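(* Let $H:T^*M\times\mathbb S^1\to\mathbb R$ be a convex superlinear Hamiltonian and let $\beta$ be Mather's beta function of its Legendre transform. Then $$-\beta(0)\le c(H).$$
   Context: Let $(M,\langle\cdot,\cdot\rangle)$ be a compact connected orientable Riemannian manifold having no nontrivial contractible closed geodesics, and $\mathbb S^1=\mathbb R/\mathbb Z$. $H:T^*M\times\mathbb S^1\to\mathbb R$ is smooth, convex (positive definite fibrewise Hessian) and fibrewise superlinear, with Legendre transform $L:TM\times\mathbb S^1\to\mathbb R$, $L(q,v,t)=\max_{p\in T_q^*M}\{p(v)-H(q,p,t)\}$, whose Euler–Lagrange flow is complete. $\mathcal M(L)$ is the set of compactly supported Borel probability measures on $TM\times\mathbb S^1$ invariant under the Euler–Lagrange flow. The rotation vector of $\mu\in\mathcal M(L)$ is the unique $\rho(\mu)\in H_1(M,\mathbb R)$ with $\langle\omega,\rho(\mu)\rangle=\int\omega\,d\mu$ for all closed 1-forms $\omega$ on $M$ (viewed as functions on $TM$). Mather's function $\beta:H_1(M,\mathbb R)\to\mathbb R$ is $\beta(\gamma)=\inf\{\int L\,d\mu:\mu\in\mathcal M(L),\rho(\mu)=\gamma\}$. Finally $$c(H)=\inf\left\{\int_0^1\max_{q\in M}H(q,\theta(q),t)\,dt:\ \theta\text{ is a closed 1-form on }M\right\}.$$ *)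

theory Defs
  imports "HOL-Analysis.Analysis" "HOL-Homology.Homology" "HOL-Library.Poly_Mapping"
begin

section \<open>The circle \<open>\<real>/\<int>\<close>\<close>

quotient_type circle = real / "\<lambda>x y. x - y \<in> \<int>"
proof (rule equivpI)
  show "reflp (\<lambda>x y::real. x - y \<in> \<int>)"
    by (simp add: reflp_def)
  show "symp (\<lambda>x y::real. x - y \<in> \<int>)"
    unfolding symp_def by (metis Ints_minus minus_diff_eq)
  show "transp (\<lambda>x y::real. x - y \<in> \<int>)"
    unfolding transp_def by (metis Ints_add diff_add_cancel add_diff_eq)
qed

lift_definition circ :: "real \<Rightarrow> circle" is "\<lambda>t. t" .

lift_definition rotate_circle :: "real \<Rightarrow> circle \<Rightarrow> circle" is "\<lambda>t s. s + t"
  by simp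

instantiation circle :: topological_space
begin

definition open_circle :: "circle set \<Rightarrow> bool" where
  "open_circle U \<longleftrightarrow> open (circ -` U)"

instance
proof
  show "open (UNIV :: circle set)"
    by (simp add: open_circle_def)
  show "open (S \<inter> T)" if "open S" "open T" for S T :: "circle set"
    using that by (auto simp: open_circle_def)
  show "open (\<Union>K)" if "\<forall>S\<in>K. open S" for K :: "circle set set"
    using that by (auto simp: open_circle_def vimage_Union)
qed

end


section \<open>Smooth manifolds\<close>

text \<open>\<open>Ck_on k S f\<close> is meant for open \<open>S\<close>.\<close>

primrec Ck_on :: "nat \<Rightarrow> 'a::euclidean_space set \<Rightarrow> ('a \<Rightarrow> 'b::real_normed_vector) \<Rightarrow> bool" where
  "Ck_on 0 S f \<longleftrightarrow> continuous_on S f"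
| "Ck_on (Suc k) S f \<longleftrightarrow>
     (\<forall>x\<in>S. f differentiable (at x)) \<and>
     (\<forall>b\<in>Basis. Ck_on k S (\<lambda>x. frechet_derivative f (at x) b))"

definition smooth_on :: "'a::euclidean_space set \<Rightarrow> ('a \<Rightarrow> 'b::real_normed_vector) \<Rightarrow> bool" where
  "smooth_on S f \<longleftrightarrow> (\<forall>k. Ck_on k S f)"

text \<open>The manifold is the whole type \<open>'m\<close>. A chart is a pair of its domain and its map; the
  values of the map outside the domain are irrelevant. Atlases need not be maximal.\<close>

type_synonym ('m, 'n) chart = "'m set \<times> ('m \<Rightarrow> real ^ 'n)"

abbreviation chart_dom :: "('m, 'n) chart \<Rightarrow> 'm set" where
  "chart_dom c \<equiv> fst c"

abbreviation chart_map :: "('m, 'n) chart \<Rightarrow> 'm \<Rightarrow> real ^ 'n" where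
  "chart_map c \<equiv> snd c"

definition chart_img :: "('m, 'n) chart \<Rightarrow> (real ^ 'n) set" where
  "chart_img c = chart_map c ` chart_dom c"

definition chart_inv :: "('m, 'n) chart \<Rightarrow> real ^ 'n \<Rightarrow> 'm" where
  "chart_inv c = inv_into (chart_dom c) (chart_map c)"

definition transition :: "('m, 'n) chart \<Rightarrow> ('m, 'n) chart \<Rightarrow> real ^ 'n \<Rightarrow> real ^ 'n" where
  "transition c d = chart_map d \<circ> chart_inv c"

definition smooth_atlas :: "('m::t2_space, 'n::finite) chart set \<Rightarrow> bool" where
  "smooth_atlas A \<longleftrightarrow>
     (\<forall>c\<in>A. open (chart_dom c) \<and> open (chart_img c) \<and>
        homeomorphism (chart_dom c) (chart_img c) (chart_map c) (chart_inv c)) \<and>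
     (\<Union>c\<in>A. chart_dom c) = UNIV \<and>
     (\<forall>c\<in>A. \<forall>d\<in>A. smooth_on (chart_map c ` (chart_dom c \<inter> chart_dom d)) (transition c d))"

text \<open>The oriented atlas \<open>B\<close> is only required to be compatible with \<open>A\<close>, not to be a part of \<open>A\<close>.\<close>

definition orientable :: "('m::t2_space, 'n::finite) chart set \<Rightarrow> bool" where
  "orientable A \<longleftrightarrow>
     (\<exists>B. smooth_atlas B \<and> smooth_atlas (A \<union> B) \<and>
        (\<forall>c\<in>B. \<forall>d\<in>B. \<forall>x \<in> chart_map c ` (chart_dom c \<inter> chart_dom d).
           det (matrix (frechet_derivative (transition c d) (at x))) > 0))"


section \<open>Tangent and cotangent vectors\<close>

text \<open>A tangent vector at \<open>q\<close> is the family of its coordinate vectors in all charts of the atlas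
  around \<open>q\<close>, related by the derivatives of the transition maps; the family is \<open>0\<close> at all other
  charts, so that a tangent vector is determined by its coordinates in one chart.
  \<open>tvec A c q a\<close> is the tangent vector at \<open>q\<close> with coordinates \<open>a\<close> in \<open>c\<close>.\<close>

type_synonym ('m, 'n) tangent = "('m, 'n) chart \<Rightarrow> real ^ 'n"

definition tvec :: "('m, 'n::finite) chart set \<Rightarrow> ('m, 'n) chart \<Rightarrow> 'm \<Rightarrow> real ^ 'n \<Rightarrow> ('m, 'n) tangent" where
  "tvec A c q a = (\<lambda>d. if d \<in> A \<and> q \<in> chart_dom d
     then frechet_derivative (transition c d) (at (chart_map c q)) a else 0)"

definition tangent_space :: "('m, 'n::finite) chart set \<Rightarrow> 'm \<Rightarrow> ('m, 'n) tangent set" where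
  "tangent_space A q = {v. \<forall>c\<in>A. q \<in> chart_dom c \<longrightarrow> v = tvec A c q (v c)}"

definition tangent_bundle :: "('m, 'n::finite) chart set \<Rightarrow> ('m \<times> ('m, 'n) tangent) set" where
  "tangent_bundle A = {(q, v). v \<in> tangent_space A q}"

definition tangent_bundle_topology ::
    "('m, 'n::finite) chart set \<Rightarrow> ('m \<times> ('m, 'n) tangent) topology" where
  "tangent_bundle_topology A = topology_generated_by
     {{(q, v) \<in> tangent_bundle A. q \<in> chart_dom c \<and> (chart_map c q, v c) \<in> W} | c W.
        c \<in> A \<and> open W}"

text \<open>Cotangent vectors are the linear functionals on the tangent space, extended by \<open>0\<close>.
  \<open>covec A c q a\<close> is the cotangent vector at \<open>q\<close> with coordinates \<open>a\<close> in the chart \<open>c\<close>.\<close>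

type_synonym ('m, 'n) cotangent = "('m, 'n) tangent \<Rightarrow> real"

definition cotangent_space :: "('m, 'n::finite) chart set \<Rightarrow> 'm \<Rightarrow> ('m, 'n) cotangent set" where
  "cotangent_space A q = {p.
     (\<forall>v \<in> tangent_space A q. \<forall>w \<in> tangent_space A q. p (\<lambda>c. v c + w c) = p v + p w) \<and>
     (\<forall>v \<in> tangent_space A q. \<forall>r. p (\<lambda>c. r *\<^sub>R v c) = r * p v) \<and>
     (\<forall>v. v \<notin> tangent_space A q \<longrightarrow> p v = 0)}"

definition covec :: "('m, 'n::finite) chart set \<Rightarrow> ('m, 'n) chart \<Rightarrow> 'm \<Rightarrow> real ^ 'n \<Rightarrow> ('m, 'n) cotangent" where
  "covec A c q a = (\<lambda>v. if v \<in> tangent_space A q then a \<bullet> v c else 0)"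


section \<open>Curves, Riemannian metrics, geodesics\<close>

definition smooth_curve :: "('m::t2_space, 'n::finite) chart set \<Rightarrow> (real \<Rightarrow> 'm) \<Rightarrow> bool" where
  "smooth_curve A \<gamma> \<longleftrightarrow> continuous_on UNIV \<gamma> \<and>
     (\<forall>c\<in>A. smooth_on (\<gamma> -` chart_dom c) (chart_map c \<circ> \<gamma>))"

definition velocity :: "('m, 'n::finite) chart set \<Rightarrow> (real \<Rightarrow> 'm) \<Rightarrow> real \<Rightarrow> ('m, 'n) tangent" where
  "velocity A \<gamma> \<tau> = (\<lambda>c. if c \<in> A \<and> \<gamma> \<tau> \<in> chart_dom c
     then vector_derivative (chart_map c \<circ> \<gamma>) (at \<tau>) else 0)"

type_synonym ('m, 'n) metric = "'m \<Rightarrow> ('m, 'n) tangent \<Rightarrow> ('m, 'n) tangent \<Rightarrow> real"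

definition metric_coord ::
    "('m, 'n::finite) chart set \<Rightarrow> ('m, 'n) metric \<Rightarrow> ('m, 'n) chart \<Rightarrow> real ^ 'n \<Rightarrow> real ^ 'n \<Rightarrow> real ^ 'n \<Rightarrow> real" where
  "metric_coord A g c u w x =
     g (chart_inv c x) (tvec A c (chart_inv c x) u) (tvec A c (chart_inv c x) w)"

definition riemannian_metric :: "('m::t2_space, 'n::finite) chart set \<Rightarrow> ('m, 'n) metric \<Rightarrow> bool" where
  "riemannian_metric A g \<longleftrightarrow>
     (\<forall>q. \<forall>u \<in> tangent_space A q.
        g q u \<in> cotangent_space A q \<and>
        (\<forall>w \<in> tangent_space A q. g q u w = g q w u) \<and>
        (u \<noteq> (\<lambda>c. 0) \<longrightarrow> g q u u > 0)) \<and>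
     (\<forall>c\<in>A. \<forall>u w. smooth_on (chart_img c) (metric_coord A g c u w))"

text \<open>Christoffel symbols of the first kind, as a trilinear form: for basis vectors
  \<open>u = e\<^sub>i\<close>, \<open>v = e\<^sub>j\<close>, \<open>w = e\<^sub>k\<close> this is
  \<open>\<Gamma>\<^sub>k\<^sub>i\<^sub>j = (\<partial>\<^sub>i g\<^sub>j\<^sub>k + \<partial>\<^sub>j g\<^sub>i\<^sub>k - \<partial>\<^sub>k g\<^sub>i\<^sub>j) / 2\<close>.\<close>

definition christoffel ::
    "('m, 'n::finite) chart set \<Rightarrow> ('m, 'n) metric \<Rightarrow> ('m, 'n) chart \<Rightarrow>
     real ^ 'n \<Rightarrow> real ^ 'n \<Rightarrow> real ^ 'n \<Rightarrow> real ^ 'n \<Rightarrow> real" where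
  "christoffel A g c x u v w =
     (frechet_derivative (metric_coord A g c v w) (at x) u
      + frechet_derivative (metric_coord A g c u w) (at x) v
      - frechet_derivative (metric_coord A g c u v) (at x) w) / 2"

text \<open>The geodesic equation with its index lowered by the (nondegenerate) metric.\<close>

definition geodesic :: "('m::t2_space, 'n::finite) chart set \<Rightarrow> ('m, 'n) metric \<Rightarrow> (real \<Rightarrow> 'm) \<Rightarrow> bool" where
  "geodesic A g \<gamma> \<longleftrightarrow> smooth_curve A \<gamma> \<and>
     (\<forall>c\<in>A. \<forall>\<tau>. \<gamma> \<tau> \<in> chart_dom c \<longrightarrow>
        (let x = chart_map c \<circ> \<gamma>;
             x' = (\<lambda>\<sigma>. vector_derivative x (at \<sigma>));
             x'' = vector_derivative x' (at \<tau>)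
         in \<forall>w. metric_coord A g c x'' w (x \<tau>) + christoffel A g c (x \<tau>) (x' \<tau>) (x' \<tau>) w = 0))"

definition nontrivial_contractible_closed_geodesic ::
    "('m::t2_space, 'n::finite) chart set \<Rightarrow> ('m, 'n) metric \<Rightarrow> (real \<Rightarrow> 'm) \<Rightarrow> bool" where
  "nontrivial_contractible_closed_geodesic A g \<gamma> \<longleftrightarrow>
     geodesic A g \<gamma> \<and> \<not> \<gamma> constant_on UNIV \<and>
     (\<exists>T>0. (\<forall>t. \<gamma> (t + T) = \<gamma> t) \<and>
        (\<exists>q. homotopic_loops UNIV (\<lambda>r. \<gamma> (T * r)) (\<lambda>_. q)))"


section \<open>Closed 1-forms\<close>

definition form_coord ::
    "('m, 'n::finite) chart set \<Rightarrow> ('m, 'n) chart \<Rightarrow> ('m \<Rightarrow> ('m, 'n) cotangent) \<Rightarrow> real ^ 'n \<Rightarrow> real ^ 'n" where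
  "form_coord A c \<omega> x = (\<chi> i. \<omega> (chart_inv c x) (tvec A c (chart_inv c x) (axis i 1)))"

text \<open>The last condition is \<open>\<partial>\<^sub>i \<omega>\<^sub>j = \<partial>\<^sub>j \<omega>\<^sub>i\<close>, that is \<open>d\<omega> = 0\<close>.\<close>

definition closed_1form :: "('m::t2_space, 'n::finite) chart set \<Rightarrow> ('m \<Rightarrow> ('m, 'n) cotangent) \<Rightarrow> bool" where
  "closed_1form A \<omega> \<longleftrightarrow>
     (\<forall>q. \<omega> q \<in> cotangent_space A q) \<and>
     (\<forall>c\<in>A. smooth_on (chart_img c) (form_coord A c \<omega>) \<and>
        (\<forall>x \<in> chart_img c. \<forall>u w.
           frechet_derivative (form_coord A c \<omega>) (at x) u \<bullet> w =
           frechet_derivative (form_coord A c \<omega>) (at x) w \<bullet> u))"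


section \<open>Singular homology with real coefficients\<close>

text \<open>HOL-Homology has integer chains only; simplices and their faces are taken from there.\<close>

type_synonym 'a real_chain = "((nat \<Rightarrow> real) \<Rightarrow> 'a) \<Rightarrow>\<^sub>0 real"

definition real_singular_chain :: "nat \<Rightarrow> 'a topology \<Rightarrow> 'a real_chain \<Rightarrow> bool" where
  "real_singular_chain p X z \<longleftrightarrow> Poly_Mapping.keys z \<subseteq> singular_simplex_set p X"

definition real_boundary :: "nat \<Rightarrow> 'a real_chain \<Rightarrow> 'a real_chain" where
  "real_boundary p z =
     (if p = 0 then 0
      else (\<Sum>f \<in> Poly_Mapping.keys z. \<Sum>k\<le>p.
              Poly_Mapping.single (singular_face p k f) ((-1) ^ k * Poly_Mapping.lookup z f)))"

definition real_cycle :: "nat \<Rightarrow> 'a topology \<Rightarrow> 'a real_chain \<Rightarrow> bool" where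
  "real_cycle p X z \<longleftrightarrow> real_singular_chain p X z \<and> real_boundary p z = 0"

definition real_homologous :: "nat \<Rightarrow> 'a topology \<Rightarrow> ('a real_chain \<times> 'a real_chain) set" where
  "real_homologous p X = {(y, z). real_cycle p X y \<and> real_cycle p X z \<and>
     (\<exists>d. real_singular_chain (Suc p) X d \<and> real_boundary (Suc p) d = y - z)}"

definition real_homology :: "nat \<Rightarrow> 'a topology \<Rightarrow> 'a real_chain set set" where
  "real_homology p X = Collect (real_cycle p X) // real_homologous p X"

definition zero_homology_class :: "nat \<Rightarrow> 'a topology \<Rightarrow> 'a real_chain set" where
  "zero_homology_class p X = real_homologous p X `` {0}"

text \<open>Closed 1-forms are integrated over merely continuous paths by means of a primitive along
  the path, which is unique up to an additive constant.\<close>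

definition local_primitive ::
    "('m::t2_space, 'n::finite) chart set \<Rightarrow> ('m \<Rightarrow> ('m, 'n) cotangent) \<Rightarrow> 'm set \<Rightarrow> ('m \<Rightarrow> real) \<Rightarrow> bool" where
  "local_primitive A \<omega> U f \<longleftrightarrow> open U \<and>
     (\<forall>q\<in>U. \<forall>c\<in>A. q \<in> chart_dom c \<longrightarrow>
        ((f \<circ> chart_inv c) has_derivative (\<lambda>a. \<omega> q (tvec A c q a))) (at (chart_map c q)))"

definition primitive_along ::
    "('m::t2_space, 'n::finite) chart set \<Rightarrow> ('m \<Rightarrow> ('m, 'n) cotangent) \<Rightarrow> (real \<Rightarrow> 'm) \<Rightarrow> (real \<Rightarrow> real) \<Rightarrow> bool" where
  "primitive_along A \<omega> \<gamma> F \<longleftrightarrow>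
     (\<forall>t\<in>{0..1}. \<exists>U f. \<gamma> t \<in> U \<and> local_primitive A \<omega> U f \<and>
        (\<forall>\<^sub>F s in at t within {0..1}. F s - F t = f (\<gamma> s) - f (\<gamma> t)))"

definition path_integral ::
    "('m::t2_space, 'n::finite) chart set \<Rightarrow> ('m \<Rightarrow> ('m, 'n) cotangent) \<Rightarrow> (real \<Rightarrow> 'm) \<Rightarrow> real" where
  "path_integral A \<omega> \<gamma> = (THE r. \<exists>F. primitive_along A \<omega> \<gamma> F \<and> r = F 1 - F 0)"

definition simplex_path :: "((nat \<Rightarrow> real) \<Rightarrow> 'a) \<Rightarrow> real \<Rightarrow> 'a" where
  "simplex_path f t = f (\<lambda>i. if i = 0 then 1 - t else if i = 1 then t else 0)"

definition chain_integral ::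
    "('m::t2_space, 'n::finite) chart set \<Rightarrow> ('m \<Rightarrow> ('m, 'n) cotangent) \<Rightarrow> 'm real_chain \<Rightarrow> real" where
  "chain_integral A \<omega> z =
     (\<Sum>f \<in> Poly_Mapping.keys z. Poly_Mapping.lookup z f * path_integral A \<omega> (simplex_path f))"


section \<open>Hamiltonians and Lagrangians\<close>

type_synonym ('m, 'n) hamiltonian = "'m \<Rightarrow> ('m, 'n) cotangent \<Rightarrow> circle \<Rightarrow> real"
type_synonym ('m, 'n) lagrangian = "'m \<Rightarrow> ('m, 'n) tangent \<Rightarrow> circle \<Rightarrow> real"

definition smooth_hamiltonian :: "('m::t2_space, 'n::finite) chart set \<Rightarrow> ('m, 'n) hamiltonian \<Rightarrow> bool" where
  "smooth_hamiltonian A H \<longleftrightarrow>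
     (\<forall>c\<in>A. smooth_on (chart_img c \<times> UNIV \<times> UNIV)
        (\<lambda>(x, a, t). H (chart_inv c x) (covec A c (chart_inv c x) a) (circ t)))"

definition fibre_hessian ::
    "('m, 'n) hamiltonian \<Rightarrow> 'm \<Rightarrow> ('m, 'n) cotangent \<Rightarrow> circle \<Rightarrow> ('m, 'n) cotangent \<Rightarrow> ('m, 'n) cotangent \<Rightarrow> real" where
  "fibre_hessian H q p s w w' =
     deriv (\<lambda>a. deriv (\<lambda>b. H q (\<lambda>v. p v + a * w v + b * w' v) s) 0) 0"

definition fibrewise_convex :: "('m::t2_space, 'n::finite) chart set \<Rightarrow> ('m, 'n) hamiltonian \<Rightarrow> bool" where
  "fibrewise_convex A H \<longleftrightarrow>
     (\<forall>q s. \<forall>p \<in> cotangent_space A q. \<forall>w \<in> cotangent_space A q.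
        w \<noteq> (\<lambda>v. 0) \<longrightarrow> fibre_hessian H q p s w w > 0)"

definition dual_norm ::
    "('m, 'n::finite) chart set \<Rightarrow> ('m, 'n) metric \<Rightarrow> 'm \<Rightarrow> ('m, 'n) cotangent \<Rightarrow> real" where
  "dual_norm A g q p = (SUP v \<in> {v \<in> tangent_space A q. g q v v \<le> 1}. \<bar>p v\<bar>)"

definition fibrewise_superlinear ::
    "('m::t2_space, 'n::finite) chart set \<Rightarrow> ('m, 'n) metric \<Rightarrow> ('m, 'n) hamiltonian \<Rightarrow> bool" where
  "fibrewise_superlinear A g H \<longleftrightarrow>
     (\<forall>q s. \<forall>K. \<exists>R. \<forall>p \<in> cotangent_space A q.
        dual_norm A g q p \<ge> R \<longrightarrow> H q p s \<ge> K * dual_norm A g q p)"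

text \<open>For a convex superlinear \<open>H\<close> the supremum is a maximum.\<close>

definition legendre :: "('m, 'n::finite) chart set \<Rightarrow> ('m, 'n) hamiltonian \<Rightarrow> ('m, 'n) lagrangian" where
  "legendre A H q v s = (SUP p \<in> cotangent_space A q. p v - H q p s)"

definition lagrangian_coord ::
    "('m, 'n::finite) chart set \<Rightarrow> ('m, 'n) lagrangian \<Rightarrow> ('m, 'n) chart \<Rightarrow> circle \<Rightarrow>
     real ^ 'n \<Rightarrow> real ^ 'n \<Rightarrow> real" where
  "lagrangian_coord A L c s x a = L (chart_inv c x) (tvec A c (chart_inv c x) a) s"

text \<open>\<open>\<gamma>\<close> solves the Euler--Lagrange equation, its parameter being \<open>0\<close> at the time \<open>s\<close>.\<close>

definition euler_lagrange ::
    "('m::t2_space, 'n::finite) chart set \<Rightarrow> ('m, 'n) lagrangian \<Rightarrow> circle \<Rightarrow> (real \<Rightarrow> 'm) \<Rightarrow> bool" where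
  "euler_lagrange A L s \<gamma> \<longleftrightarrow> smooth_curve A \<gamma> \<and>
     (\<forall>c\<in>A. \<forall>\<tau>. \<gamma> \<tau> \<in> chart_dom c \<longrightarrow>
        (let x = chart_map c \<circ> \<gamma>;
             x' = (\<lambda>\<sigma>. vector_derivative x (at \<sigma>));
             \<L> = (\<lambda>\<sigma>. lagrangian_coord A L c (rotate_circle \<sigma> s))
         in \<forall>w. ((\<lambda>\<sigma>. frechet_derivative (\<lambda>a. \<L> \<sigma> (x \<sigma>) a) (at (x' \<sigma>)) w)
                 has_real_derivative frechet_derivative (\<lambda>y. \<L> \<tau> y (x' \<tau>)) (at (x \<tau>)) w) (at \<tau>)))"

definition el_orbit ::
    "('m::t2_space, 'n::finite) chart set \<Rightarrow> ('m, 'n) lagrangian \<Rightarrow> ('m \<times> ('m, 'n) tangent) \<times> circle \<Rightarrow>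
     (real \<Rightarrow> 'm) \<Rightarrow> bool" where
  "el_orbit A L = (\<lambda>((q, v), s) \<gamma>. euler_lagrange A L s \<gamma> \<and> \<gamma> 0 = q \<and> velocity A \<gamma> 0 = v)"

definition complete_el_flow :: "('m::t2_space, 'n::finite) chart set \<Rightarrow> ('m, 'n) lagrangian \<Rightarrow> bool" where
  "complete_el_flow A L \<longleftrightarrow> (\<forall>x \<in> tangent_bundle A \<times> UNIV. \<exists>\<gamma>. el_orbit A L x \<gamma>)"

text \<open>For a Tonelli Lagrangian the orbit chosen here is unique.\<close>

definition el_flow ::
    "('m::t2_space, 'n::finite) chart set \<Rightarrow> ('m, 'n) lagrangian \<Rightarrow> real \<Rightarrow>
     ('m \<times> ('m, 'n) tangent) \<times> circle \<Rightarrow> ('m \<times> ('m, 'n) tangent) \<times> circle" where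
  "el_flow A L \<tau> x =
     (let \<gamma> = (SOME \<gamma>. el_orbit A L x \<gamma>)
      in ((\<gamma> \<tau>, velocity A \<gamma> \<tau>), rotate_circle \<tau> (snd x)))"


section \<open>Invariant measures and Mather's function\<close>

definition phase_topology ::
    "('m::t2_space, 'n::finite) chart set \<Rightarrow> (('m \<times> ('m, 'n) tangent) \<times> circle) topology" where
  "phase_topology A = prod_topology (tangent_bundle_topology A) euclidean"

definition invariant_measures ::
    "('m::t2_space, 'n::finite) chart set \<Rightarrow> ('m, 'n) lagrangian \<Rightarrow>
     (('m \<times> ('m, 'n) tangent) \<times> circle) measure set" where
  "invariant_measures A L = {\<mu>.
     sets \<mu> = sets (sigma (topspace (phase_topology A)) {U. openin (phase_topology A) U}) \<and>
     emeasure \<mu> (space \<mu>) = 1 \<and>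
     (\<exists>K. compactin (phase_topology A) K \<and> (AE x in \<mu>. x \<in> K)) \<and>
     (\<forall>\<tau>. el_flow A L \<tau> \<in> measurable \<mu> \<mu> \<and> distr \<mu> \<mu> (el_flow A L \<tau>) = \<mu>)}"

text \<open>\<open>\<rho>(\<mu>) = \<gamma>\<close>. The integral of a closed form does not depend on the representing cycle.\<close>

definition has_rotation_vector ::
    "('m::t2_space, 'n::finite) chart set \<Rightarrow> (('m \<times> ('m, 'n) tangent) \<times> circle) measure \<Rightarrow>
     'm real_chain set \<Rightarrow> bool" where
  "has_rotation_vector A \<mu> \<gamma> \<longleftrightarrow> \<gamma> \<in> real_homology 1 euclidean \<and>
     (\<forall>\<omega>. closed_1form A \<omega> \<longrightarrow>
        (\<forall>z\<in>\<gamma>. chain_integral A \<omega> z = (\<integral>((q, v), s). \<omega> q v \<partial>\<mu>)))"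

definition mather_beta ::
    "('m::t2_space, 'n::finite) chart set \<Rightarrow> ('m, 'n) lagrangian \<Rightarrow> 'm real_chain set \<Rightarrow> ereal" where
  "mather_beta A L \<gamma> =
     (INF \<mu> \<in> {\<mu> \<in> invariant_measures A L. has_rotation_vector A \<mu> \<gamma>}.
        ereal (\<integral>((q, v), s). L q v s \<partial>\<mu>))"

definition c_ham :: "('m::t2_space, 'n::finite) chart set \<Rightarrow> ('m, 'n) hamiltonian \<Rightarrow> real" where
  "c_ham A H =
     (INF \<theta> \<in> {\<theta>. closed_1form A \<theta>}. integral {0..1} (\<lambda>t. SUP q. H q (\<theta> q) (circ t)))"

end

theory Submission
  imports Defs
begin

text \<open>
  Let \<open>\<mu>\<close> be an invariant measure with rotation vector \<open>0\<close> and \<open>\<theta>\<close> a closed 1-form. Integrating the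
  Fenchel inequality \<open>L(q, v, t) \<ge> \<theta>(v) - H(q, \<theta>(q), t)\<close> over \<open>\<mu>\<close> kills the term \<open>\<theta>(v)\<close>, and the
  projection of \<open>\<mu>\<close> to the circle is rotation invariant, so that
  \<open>\<integral>L d\<mu> \<ge> - \<integral>\<^sub>0\<^sup>1 max\<^sub>q H(q, \<theta>(q), t) dt\<close>. The invariance of the projection is used in averaged form,
  through Fubini's theorem. The remaining work is the \<open>\<mu>\<close>-integrability of \<open>L\<close>: as a supremum of
  continuous functions it is lower semicontinuous, hence Borel, and convexity of \<open>H\<close> makes
  superlinearity locally uniform, hence \<open>L\<close> locally bounded.
\<close>

section \<open>Calculus of smooth functions on open sets\<close>

lemma smooth_on_imp_continuous_on: "smooth_on S f \<Longrightarrow> continuous_on S f"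
  unfolding smooth_on_def by (metis Ck_on.simps(1))

lemma smooth_on_imp_has_derivative:
  assumes "smooth_on S f" "x \<in> S"
  shows "(f has_derivative frechet_derivative f (at x)) (at x)"
  using assms unfolding smooth_on_def by (metis Ck_on.simps(2) frechet_derivative_works)

lemma smooth_on_frechet_derivative:
  assumes "smooth_on S f" "b \<in> Basis"
  shows "smooth_on S (\<lambda>x. frechet_derivative f (at x) b)"
  using assms unfolding smooth_on_def by (metis Ck_on.simps(2))

lemma smooth_on_zero: "smooth_on S (\<lambda>x. 0 :: 'b::real_normed_vector)"
proof -
  have "Ck_on k S (\<lambda>x. 0 :: 'b)" for k
    by (induction k) auto
  then show ?thesis
    by (simp add: smooth_on_def)
qed

section \<open>Charts and coordinates of (co)tangent vectors\<close>

lemma smooth_atlas_chart: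
  assumes "smooth_atlas A" "c \<in> A"
  shows "open (chart_dom c)" "open (chart_img c)"
    "homeomorphism (chart_dom c) (chart_img c) (chart_map c) (chart_inv c)"
  using assms by (auto simp: smooth_atlas_def)

lemma smooth_atlas_cover:
  assumes "smooth_atlas A"
  obtains c where "c \<in> A" "q \<in> chart_dom c"
  using assms unfolding smooth_atlas_def by blast

lemma chart_map_in: "q \<in> chart_dom c \<Longrightarrow> chart_map c q \<in> chart_img c"
  by (simp add: chart_img_def)

lemma chart_inv_map [simp]:
  "smooth_atlas A \<Longrightarrow> c \<in> A \<Longrightarrow> q \<in> chart_dom c \<Longrightarrow> chart_inv c (chart_map c q) = q"
  by (meson homeomorphism_apply1 smooth_atlas_chart(3))

lemma chart_map_inv [simp]:
  "smooth_atlas A \<Longrightarrow> c \<in> A \<Longrightarrow> x \<in> chart_img c \<Longrightarrow> chart_map c (chart_inv c x) = x"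
  by (meson homeomorphism_apply2 smooth_atlas_chart(3))

lemma chart_inv_in: "x \<in> chart_img c \<Longrightarrow> chart_inv c x \<in> chart_dom c"
  by (auto simp: chart_img_def chart_inv_def intro: inv_into_into)

lemma open_chart_overlap:
  assumes "smooth_atlas A" "c \<in> A" "d \<in> A"
  shows "open (chart_map c ` (chart_dom c \<inter> chart_dom d))"
proof -
  have "openin (top_of_set (chart_img c)) (chart_map c ` (chart_dom c \<inter> chart_dom d))"
    using assms by (intro homeomorphism_imp_open_map[OF smooth_atlas_chart(3)[of A c]])
      (auto simp: openin_open_Int smooth_atlas_chart(1))
  then show ?thesis
    using assms openin_open_trans smooth_atlas_chart(2) by blast
qed

lemma transition_has_derivative:
  assumes "smooth_atlas A" "c \<in> A" "d \<in> A" "q \<in> chart_dom c" "q \<in> chart_dom d"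
  shows "(transition c d has_derivative frechet_derivative (transition c d) (at (chart_map c q)))
           (at (chart_map c q))"
  using assms by (intro smooth_on_imp_has_derivative[of "chart_map c ` (chart_dom c \<inter> chart_dom d)"])
    (auto simp: smooth_atlas_def)

text \<open>Transition maps satisfy the cocycle identity, so by the chain rule their derivatives do
  too. This is the compatibility that \<open>tangent_space\<close> asks of a family of coordinate
  vectors.\<close>

lemma tvec_in_tangent_space:
  assumes A: "smooth_atlas A" and c: "c \<in> A" "q \<in> chart_dom c"
  shows "tvec A c q a \<in> tangent_space A q"
proof -
  have "tvec A c q a e = tvec A d q (tvec A c q a d) e" if d: "d \<in> A" "q \<in> chart_dom d" for d e
  proof (cases "e \<in> A \<and> q \<in> chart_dom e")
    case True
    \<comment> \<open>The cocycle identity holds only on this neighbourhood of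
      \<open>chart_map c q\<close>, since \<open>chart_inv\<close> returns arbitrary values off the
      chart images. That suffices for derivatives at the point.\<close>
    let ?S = "chart_map c ` (chart_dom c \<inter> chart_dom d) \<inter> chart_map c ` (chart_dom c \<inter> chart_dom e)"
    have "open ?S"
      using A c d True by (intro open_Int open_chart_overlap) auto
    moreover have "chart_map c q \<in> ?S"
      using c(2) d(2) True by blast
    moreover have "(transition d e \<circ> transition c d) x = transition c e x" if x: "x \<in> ?S" for x
    proof -
      obtain q' where "q' \<in> chart_dom c" "q' \<in> chart_dom d" "x = chart_map c q'"
        using x by blast
      then have "chart_inv c x \<in> chart_dom d"
        using A c(1) by simp
      then show ?thesis
        using A d(1) by (simp add: transition_def)
    qed
    moreover have "(transition d e \<circ> transition c d has_derivative
        frechet_derivative (transition d e) (at (chart_map d q)) \<circ>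
        frechet_derivative (transition c d) (at (chart_map c q))) (at (chart_map c q))"
      using A c d True transition_has_derivative[of A d e q]
      by (intro diff_chain_at transition_has_derivative[of A]) (auto simp: transition_def)
    ultimately have "(transition c e has_derivative
        frechet_derivative (transition d e) (at (chart_map d q)) \<circ>
        frechet_derivative (transition c d) (at (chart_map c q))) (at (chart_map c q))"
      using has_derivative_transform_within_open by blast
    then have "frechet_derivative (transition c e) (at (chart_map c q)) =
        frechet_derivative (transition d e) (at (chart_map d q)) \<circ>
        frechet_derivative (transition c d) (at (chart_map c q))"
      by (metis frechet_derivative_at)
    then show ?thesis
      using True d by (simp add: tvec_def)
  qed (auto simp: tvec_def)
  then show ?thesis
    unfolding tangent_space_def mem_Collect_eq by (intro ballI impI ext)
qed

lemma tvec_self [simp]: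
  assumes "smooth_atlas A" "c \<in> A" "q \<in> chart_dom c"
  shows "tvec A c q a c = a"
proof -
  have "((\<lambda>x. x) has_derivative (\<lambda>x. x)) (at (chart_map c q))"
    by (rule has_derivative_ident)
  then have "(transition c c has_derivative (\<lambda>x. x)) (at (chart_map c q))"
    by (rule has_derivative_transform_within_open[OF _ smooth_atlas_chart(2)[OF assms(1,2)] chart_map_in[OF assms(3)]])
      (use assms in \<open>auto simp: transition_def\<close>)
  then have "frechet_derivative (transition c c) (at (chart_map c q)) = (\<lambda>x. x)"
    by (metis frechet_derivative_at)
  then show ?thesis
    using assms by (simp add: tvec_def)
qed

lemma tvec_linear:
  assumes "smooth_atlas A" "c \<in> A" "q \<in> chart_dom c"
  shows "tvec A c q (a + b) = (\<lambda>d. tvec A c q a d + tvec A c q b d)"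
    and "tvec A c q (r *\<^sub>R a) = (\<lambda>d. r *\<^sub>R tvec A c q a d)"
proof -
  have "linear (frechet_derivative (transition c d) (at (chart_map c q)))"
    if "d \<in> A" "q \<in> chart_dom d" for d
    using transition_has_derivative[of A c d q] assms that has_derivative_linear by blast
  then show "tvec A c q (a + b) = (\<lambda>d. tvec A c q a d + tvec A c q b d)"
    and "tvec A c q (r *\<^sub>R a) = (\<lambda>d. r *\<^sub>R tvec A c q a d)"
    by (auto simp: tvec_def fun_eq_iff linear_add linear_scale)
qed

lemma tangent_space_eq_tvec:
  "v \<in> tangent_space A q \<Longrightarrow> c \<in> A \<Longrightarrow> q \<in> chart_dom c \<Longrightarrow> v = tvec A c q (v c)"
  by (simp add: tangent_space_def)

lemma tangent_space_linear:
  assumes "smooth_atlas A" "v \<in> tangent_space A q"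
  shows "w \<in> tangent_space A q \<Longrightarrow> (\<lambda>d. v d + w d) \<in> tangent_space A q"
    and "(\<lambda>d. r *\<^sub>R v d) \<in> tangent_space A q"
proof -
  obtain c where c: "c \<in> A" "q \<in> chart_dom c"
    using assms(1) smooth_atlas_cover by blast
  \<comment> \<open>As a rewrite rule this equation would loop, because \<open>v\<close> occurs on
    both sides; it is applied only from right to left below.\<close>
  have v: "v = tvec A c q (v c)"
    by (rule tangent_space_eq_tvec[OF assms(2) c])
  show "(\<lambda>d. v d + w d) \<in> tangent_space A q" if "w \<in> tangent_space A q"
  proof -
    have "tvec A c q (v c + w c) = (\<lambda>d. tvec A c q (v c) d + tvec A c q (w c) d)"
      by (rule tvec_linear[OF assms(1) c])
    also have "\<dots> = (\<lambda>d. v d + w d)"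
      by (simp only: v[symmetric] tangent_space_eq_tvec[OF that c, symmetric])
    finally show ?thesis
      by (rule subst[where P = "\<lambda>u. u \<in> tangent_space A q"])
        (rule tvec_in_tangent_space[OF assms(1) c])
  qed
  have "tvec A c q (r *\<^sub>R v c) = (\<lambda>d. r *\<^sub>R tvec A c q (v c) d)"
    by (rule tvec_linear[OF assms(1) c])
  also have "\<dots> = (\<lambda>d. r *\<^sub>R v d)"
    by (simp only: v[symmetric])
  finally show "(\<lambda>d. r *\<^sub>R v d) \<in> tangent_space A q"
    by (rule subst[where P = "\<lambda>u. u \<in> tangent_space A q"])
      (rule tvec_in_tangent_space[OF assms(1) c])
qed

lemma covec_in_cotangent_space:
  assumes "smooth_atlas A"
  shows "covec A c q a \<in> cotangent_space A q"
  unfolding cotangent_space_def mem_Collect_eq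
proof (intro conjI ballI allI impI)
  fix v w r
  assume v: "v \<in> tangent_space A q"
  show "covec A c q a (\<lambda>d. r *\<^sub>R v d) = r * covec A c q a v"
    using v tangent_space_linear(2)[OF assms v, of r] by (simp add: covec_def)
  assume w: "w \<in> tangent_space A q"
  show "covec A c q a (\<lambda>d. v d + w d) = covec A c q a v + covec A c q a w"
    using v w tangent_space_linear(1)[OF assms v w] by (simp add: covec_def inner_add_right)
qed (simp add: covec_def)

lemma linear_cotangent_tvec:
  assumes "smooth_atlas A" "c \<in> A" "q \<in> chart_dom c" "p \<in> cotangent_space A q"
  shows "linear (\<lambda>a. p (tvec A c q a))"
proof (rule linearI)
  show "p (tvec A c q (a + b)) = p (tvec A c q a) + p (tvec A c q b)" for a b
    using assms(4) tvec_in_tangent_space[OF assms(1-3)]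
    unfolding tvec_linear[OF assms(1-3)] cotangent_space_def by blast
  show "p (tvec A c q (r *\<^sub>R a)) = r *\<^sub>R p (tvec A c q a)" for r a
    using assms(4) tvec_in_tangent_space[OF assms(1-3)]
    unfolding tvec_linear[OF assms(1-3)] cotangent_space_def real_scaleR_def by blast
qed

text \<open>On the tangent space a functional is determined by its values on the coordinate basis;
  elsewhere both sides vanish by convention.\<close>

lemma cotangent_eq_covec:
  assumes "smooth_atlas A" "c \<in> A" "q \<in> chart_dom c" "p \<in> cotangent_space A q"
  shows "p = covec A c q (\<chi> i. p (tvec A c q (axis i 1)))"
proof
  fix v
  show "p v = covec A c q (\<chi> i. p (tvec A c q (axis i 1))) v"
  proof (cases "v \<in> tangent_space A q")
    case True
    interpret linear "\<lambda>a. p (tvec A c q a)"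
      by (rule linear_cotangent_tvec[OF assms])
    have "p v = p (tvec A c q (v c))"
      by (rule arg_cong[OF tangent_space_eq_tvec[OF True assms(2,3)]])
    also have "v c = (\<Sum>i\<in>UNIV. v c $ i *\<^sub>R axis i 1)"
      using basis_expansion[of "v c"] by (simp add: scalar_mult_eq_scaleR)
    also have "p (tvec A c q \<dots>) = (\<Sum>i\<in>UNIV. v c $ i * p (tvec A c q (axis i 1)))"
      by (simp add: sum scale)
    finally show ?thesis
      using True by (simp add: covec_def inner_vec_def mult.commute)
  next
    case False
    then show ?thesis
      using assms(4) by (simp add: covec_def cotangent_space_def)
  qed
qed

text \<open>Turns the supremum over covectors in \<open>legendre\<close> into a supremum over a
  fixed Euclidean space, the same for all points of a chart.\<close>

lemma cotangent_space_eq_range_covec: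
  assumes "smooth_atlas A" "c \<in> A" "q \<in> chart_dom c"
  shows "cotangent_space A q = range (covec A c q)"
proof (intro equalityI subsetI)
  show "p \<in> range (covec A c q)" if "p \<in> cotangent_space A q" for p
    by (subst cotangent_eq_covec[OF assms that]) (rule rangeI)
  show "p \<in> cotangent_space A q" if "p \<in> range (covec A c q)" for p
    using that covec_in_cotangent_space[OF assms(1)] by fast
qed

lemma covec_tvec [simp]:
  assumes "smooth_atlas A" "c \<in> A" "q \<in> chart_dom c"
  shows "covec A c q a (tvec A c q b) = a \<bullet> b"
  using assms by (simp add: covec_def tvec_in_tangent_space)

lemma covec_add_scaleR:
  "covec A c q (a + r *\<^sub>R b) = (\<lambda>v. covec A c q a v + r * covec A c q b v)"
  by (auto simp: covec_def inner_add_left)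

lemma closed_1form_eq_covec:
  assumes "smooth_atlas A" "c \<in> A" "x \<in> chart_img c" "closed_1form A \<theta>"
  shows "\<theta> (chart_inv c x) = covec A c (chart_inv c x) (form_coord A c \<theta> x)"
  using assms cotangent_eq_covec[of A c "chart_inv c x" "\<theta> (chart_inv c x)"]
  by (simp add: form_coord_def closed_1form_def chart_inv_in)

section \<open>Fibrewise convex functions and their Legendre transforms\<close>

text \<open>\<open>Ck_on\<close> speaks of derivatives along basis vectors only; a general direction
  is a fixed linear combination of them.\<close>

lemma smooth_on_directional_derivative:
  assumes S: "open S" and f: "smooth_on S f" and z: "z \<in> S"
  shows "(\<lambda>y. frechet_derivative f (at y) e) differentiable (at z)"
proof -
  have "((\<lambda>y. \<Sum>b\<in>Basis. (e \<bullet> b) *\<^sub>R frechet_derivative f (at y) b) has_derivative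
      (\<lambda>h. \<Sum>b\<in>Basis. (e \<bullet> b) *\<^sub>R frechet_derivative (\<lambda>x. frechet_derivative f (at x) b) (at z) h)) (at z)"
    by (intro has_derivative_sum has_derivative_scaleR_right
        smooth_on_imp_has_derivative[OF smooth_on_frechet_derivative[OF f] z])
  moreover have "(\<Sum>b\<in>Basis. (e \<bullet> b) *\<^sub>R frechet_derivative f (at y) b) = frechet_derivative f (at y) e"
    if "y \<in> S" for y
  proof -
    interpret linear "frechet_derivative f (at y)"
      using smooth_on_imp_has_derivative[OF f that] by (rule has_derivative_linear)
    have "frechet_derivative f (at y) e = frechet_derivative f (at y) (\<Sum>b\<in>Basis. (e \<bullet> b) *\<^sub>R b)"
      by (simp only: euclidean_representation)
    then show ?thesis
      by (simp only: sum scale)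
  qed
  ultimately show ?thesis
    by (intro differentiableI) (rule has_derivative_transform_within_open[OF _ S z])
qed

text \<open>Along every line of the fibre the second derivative is the Hessian evaluated on the
  direction of the line, hence positive. The nested form of \<open>hess\<close> is that of
  \<open>fibre_hessian\<close>.\<close>

lemma convex_on_fibre:
  fixes F :: "'a::euclidean_space \<times> 'b::euclidean_space \<times> real \<Rightarrow> real"
  assumes S: "open S" and F: "smooth_on (S \<times> UNIV \<times> UNIV) F" and x: "x \<in> S"
    and hess: "\<And>a e. e \<noteq> 0 \<Longrightarrow> deriv (\<lambda>r. deriv (\<lambda>s. F (x, a + r *\<^sub>R e + s *\<^sub>R e, t)) 0) 0 > 0"
  shows "convex_on UNIV (\<lambda>a. F (x, a, t))"
proof (rule convex_onI)
  fix u :: real and a b :: 'b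
  assume u: "u > 0" "u < 1"
  show "F (x, (1 - u) *\<^sub>R a + u *\<^sub>R b, t) \<le> (1 - u) * F (x, a, t) + u * F (x, b, t)"
  proof (cases "a = b")
    case True
    then show ?thesis
      by (simp add: algebra_simps flip: scaleR_add_left)
  next
    case False
    define e where "e = b - a"
    \<comment> \<open>\<open>p\<close> runs through the line from \<open>a\<close> to
      \<open>b\<close> in the fibre over \<open>x\<close>, and \<open>D\<close> is the derivative of
      \<open>F\<close> in its direction.\<close>
    define p where "p r = (x, a + r *\<^sub>R e, t)" for r :: real
    define D where "D z = frechet_derivative F (at z) (0, e, 0)" for z
    have Om: "open (S \<times> (UNIV :: 'b set) \<times> (UNIV :: real set))"
      by (intro open_Times S open_UNIV)
    have p: "p r \<in> S \<times> UNIV \<times> UNIV" for r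
      using x by (simp add: p_def)
    have p': "(p has_derivative (\<lambda>h. (0, h *\<^sub>R e, 0))) (at r)" for r
      unfolding p_def by (auto intro!: derivative_eq_intros)
    have D1: "((\<lambda>r. F (p r)) has_real_derivative D (p r)) (at r)" for r
    proof -
      interpret linear "frechet_derivative F (at (p r))"
        using smooth_on_imp_has_derivative[OF F p] by (rule has_derivative_linear)
      have "(\<lambda>h. frechet_derivative F (at (p r)) (0, h *\<^sub>R e, 0)) = (*) (D (p r))"
        using scale[of _ "(0, e, 0)"] by (simp add: D_def fun_eq_iff)
      with has_derivative_compose[OF p' smooth_on_imp_has_derivative[OF F p], of r] show ?thesis
        by (simp add: has_field_derivative_def)
    qed
    have D2: "((\<lambda>r. D (p r)) has_real_derivative deriv (\<lambda>r. D (p r)) r) (at r)" for r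
    proof -
      have "D differentiable (at (p r))"
        unfolding D_def by (rule smooth_on_directional_derivative[OF Om F p])
      then have "(\<lambda>r. D (p r)) differentiable (at r)"
        using p' differentiable_chain_at[of p r D] unfolding o_def differentiable_def by blast
      then show ?thesis
        by (simp add: DERIV_deriv_iff_real_differentiable)
    qed
    have D2_pos: "deriv (\<lambda>r. D (p r)) r > 0" for r
    proof -
      \<comment> \<open>\<open>hess\<close> takes both derivatives at the parameter 0. Moving the
        base point to \<open>a + r *\<^sub>R e\<close> turns this into the second derivative at
        \<open>r\<close>.\<close>
      have inner: "deriv (\<lambda>s. F (x, (a + r *\<^sub>R e) + r' *\<^sub>R e + s *\<^sub>R e, t)) 0 = D (p (r + r'))" for r'
      proof -
        have "((\<lambda>s. F (p ((r + r') + s))) has_real_derivative D (p (r + r'))) (at 0)"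
          using D1[of "r + r'"] DERIV_shift[of "\<lambda>r. F (p r)" _ 0 "r + r'"] by (simp add: add_ac)
        moreover have "p ((r + r') + s) = (x, (a + r *\<^sub>R e) + r' *\<^sub>R e + s *\<^sub>R e, t)" for s
          by (simp add: p_def algebra_simps)
        ultimately show ?thesis
          by (simp add: DERIV_imp_deriv)
      qed
      have "((\<lambda>r'. D (p (r + r'))) has_real_derivative deriv (\<lambda>r. D (p r)) r) (at 0)"
        using D2[of r] DERIV_shift[of "\<lambda>r. D (p r)" _ 0 r] by (simp add: add.commute)
      then have "deriv (\<lambda>r'. D (p (r + r'))) 0 = deriv (\<lambda>r. D (p r)) r"
        by (rule DERIV_imp_deriv)
      moreover have "e \<noteq> 0"
        using False by (simp add: e_def)
      ultimately show ?thesis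
        using hess[of e "a + r *\<^sub>R e"] unfolding inner by simp
    qed
    have "convex_on UNIV (\<lambda>r. F (p r))"
      using D1 D2 D2_pos by (intro f''_ge0_imp_convex[of UNIV _ "\<lambda>r. D (p r)"]) (auto intro: less_imp_le)
    from convex_onD[OF this, of u 0 1] u show ?thesis
      by (simp add: p_def e_def algebra_simps)
  qed
qed simp

text \<open>Pointwise superlinearity alone would not be locally uniform: convexity propagates the
  inequality from a sphere, where compactness makes it uniform, to the outside of the sphere.\<close>

lemma locally_uniformly_coercive:
  fixes F :: "'a::euclidean_space \<times> 'b::euclidean_space \<times> real \<Rightarrow> real"
  assumes S: "open S" and cont: "continuous_on (S \<times> UNIV \<times> UNIV) F" and x0: "x0 \<in> S"
    and conv: "\<And>x t. x \<in> S \<Longrightarrow> convex_on UNIV (\<lambda>a. F (x, a, t))"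
    and superlin: "\<And>K. \<exists>R. \<forall>a. norm a \<ge> R \<longrightarrow> F (x0, a, t0) \<ge> K * norm a"
  obtains R \<delta> where "R > 0" "\<delta> > 0" "cball x0 \<delta> \<subseteq> S"
    "\<forall>x\<in>cball x0 \<delta>. \<forall>t\<in>cball t0 \<delta>. \<forall>a. norm a \<ge> R \<longrightarrow> F (x, a, t) \<ge> F (x, 0, t) + K * norm a"
proof -
  obtain \<delta>0 where \<delta>0: "\<delta>0 > 0" "cball x0 \<delta>0 \<subseteq> S"
    using S x0 open_contains_cball by blast
  \<comment> \<open>The slope is enlarged so that on a sphere of radius at least 1 the desired
    inequality holds at \<open>(x0, t0)\<close> with a surplus of 1. The surplus absorbs the
    oscillation of \<open>G\<close>, which is less than 1 for nearby \<open>x\<close> and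
    \<open>t\<close>.\<close>
  obtain R0 where R0: "\<And>a. norm a \<ge> R0 \<Longrightarrow> F (x0, a, t0) \<ge> (K + 1 + \<bar>F (x0, 0, t0)\<bar>) * norm a"
    using superlin by blast
  define R where "R = max R0 1"
  define G where "G = (\<lambda>(x, a, t). F (x, a, t) - F (x, 0, t) - K * R)"
  let ?C = "cball x0 \<delta>0 \<times> sphere (0::'b) R \<times> cball t0 1"
  have "continuous_on ?C (\<lambda>z. F (fst z, fst (snd z), snd (snd z)) - F (fst z, 0, snd (snd z)) - K * R)"
    using \<delta>0 by (intro continuous_intros continuous_on_compose2[OF cont]) auto
  then have "uniformly_continuous_on ?C G"
    unfolding G_def case_prod_beta by (intro compact_uniformly_continuous compact_Times) auto
  then obtain d where d: "d > 0" "\<And>z z'. z \<in> ?C \<Longrightarrow> z' \<in> ?C \<Longrightarrow> dist z' z < d \<Longrightarrow> dist (G z') (G z) < 1"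
    unfolding uniformly_continuous_on_def using zero_less_one by metis
  define \<delta> where "\<delta> = min (min \<delta>0 1) (d / 3)"
  have \<delta>: "\<delta> > 0" "\<delta> \<le> \<delta>0" "\<delta> \<le> 1" "\<delta> < d / 2"
    using \<delta>0 d by (auto simp: \<delta>_def min_def)
  have R: "R \<ge> 1" "R \<ge> R0"
    by (auto simp: R_def)
  have sphere: "F (x, a, t) \<ge> F (x, 0, t) + K * R"
    if x: "x \<in> cball x0 \<delta>" and t: "t \<in> cball t0 \<delta>" and a: "norm a = R" for x t a
  proof -
    have "dist (x, a, t) (x0, a, t0) \<le> dist x x0 + dist t t0"
      by (simp add: dist_Pair_Pair sqrt_sum_squares_le_sum)
    also have "\<dots> < d"
      using x t \<delta> by (simp add: dist_commute)
    finally have "dist (G (x, a, t)) (G (x0, a, t0)) < 1"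
      using x t a \<delta> \<delta>0 by (intro d) auto
    moreover have "(K + 1 + \<bar>F (x0, 0, t0)\<bar>) * R \<ge> K * R + 1 + \<bar>F (x0, 0, t0)\<bar>"
      using mult_left_mono[of 1 R "1 + \<bar>F (x0, 0, t0)\<bar>"] R by (simp add: algebra_simps)
    then have "G (x0, a, t0) \<ge> 1"
      using R0[of a] a R by (simp add: G_def)
    ultimately show ?thesis
      by (simp add: G_def dist_real_def)
  qed
  show ?thesis
  proof (rule that)
    show "R > 0" "\<delta> > 0" "cball x0 \<delta> \<subseteq> S"
      using R \<delta> \<delta>0 by auto
    have "F (x, a, t) \<ge> F (x, 0, t) + K * norm a"
      if x: "x \<in> cball x0 \<delta>" and t: "t \<in> cball t0 \<delta>" and a: "norm a \<ge> R" for x t a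
    proof -
      \<comment> \<open>The point \<open>u *\<^sub>R a\<close> is where the segment from 0 to
        \<open>a\<close> meets the sphere. Convexity along this segment carries the inequality from
        there out to \<open>a\<close>.\<close>
      define u where "u = R / norm a"
      have u: "0 \<le> u" "u \<le> 1" "u * norm a = R"
        using R a by (auto simp: u_def divide_simps)
      have xS: "x \<in> S"
        using x \<delta> \<delta>0 by auto
      have "F (x, 0, t) + K * R \<le> F (x, u *\<^sub>R a, t)"
        using u by (intro sphere x t) simp
      also have "F (x, u *\<^sub>R a, t) \<le> (1 - u) * F (x, 0, t) + u * F (x, a, t)"
        using convex_onD[OF conv[OF xS], of u 0 a t] u by simp
      finally have "u * (F (x, 0, t) + K * norm a) \<le> u * F (x, a, t)"
        unfolding u(3)[symmetric] by (simp add: algebra_simps)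
      moreover have "u > 0"
        using R a by (auto simp: u_def intro!: divide_pos_pos)
      ultimately show ?thesis
        by simp
    qed
    then show "\<forall>x\<in>cball x0 \<delta>. \<forall>t\<in>cball t0 \<delta>. \<forall>a. norm a \<ge> R \<longrightarrow> F (x, a, t) \<ge> F (x, 0, t) + K * norm a"
      by blast
  qed
qed

text \<open>Coercivity with slope \<open>K\<close> dominates \<open>a \<bullet> b\<close> outside a
  ball, and compactness bounds everything inside it. The bound on \<open>F (x, 0, t)\<close> serves
  for the lower estimate of the Legendre transform, whose competitor is
  \<open>a = 0\<close>.\<close>

lemma legendre_locally_bounded:
  fixes F :: "'a::euclidean_space \<times> 'b::euclidean_space \<times> real \<Rightarrow> real"
  assumes S: "open S" and cont: "continuous_on (S \<times> UNIV \<times> UNIV) F" and x0: "x0 \<in> S"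
    and conv: "\<And>x t. x \<in> S \<Longrightarrow> convex_on UNIV (\<lambda>a. F (x, a, t))"
    and superlin: "\<And>K. \<exists>R. \<forall>a. norm a \<ge> R \<longrightarrow> F (x0, a, t0) \<ge> K * norm a"
  obtains \<delta> B where "\<delta> > 0" "cball x0 \<delta> \<subseteq> S"
    "\<forall>x\<in>cball x0 \<delta>. \<forall>t\<in>cball t0 \<delta>. \<bar>F (x, 0, t)\<bar> \<le> B \<and>
       (\<forall>a b. norm b \<le> K \<longrightarrow> a \<bullet> b - F (x, a, t) \<le> B)"
proof -
  obtain R \<delta> where R: "R > 0" "\<delta> > 0" "cball x0 \<delta> \<subseteq> S"
    and outer: "\<forall>x\<in>cball x0 \<delta>. \<forall>t\<in>cball t0 \<delta>. \<forall>a. norm a \<ge> R \<longrightarrow> F (x, a, t) \<ge> F (x, 0, t) + K * norm a"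
    by (rule locally_uniformly_coercive[OF S cont x0 conv superlin, of K])
  have "bounded (F ` (cball x0 \<delta> \<times> cball 0 R \<times> cball t0 \<delta>))"
    using R by (intro compact_imp_bounded compact_continuous_image compact_Times
        continuous_on_subset[OF cont]) auto
  then obtain B0 where "\<forall>y\<in>F ` (cball x0 \<delta> \<times> cball 0 R \<times> cball t0 \<delta>). norm y \<le> B0"
    unfolding bounded_iff by blast
  from bspec[OF this imageI] have B0: "\<bar>F (x, a, t)\<bar> \<le> B0"
    if "x \<in> cball x0 \<delta>" "norm a \<le> R" "t \<in> cball t0 \<delta>" for x a t
    using that by simp
  have "\<bar>F (x, 0, t)\<bar> \<le> R * \<bar>K\<bar> + B0 \<and> (\<forall>a b. norm b \<le> K \<longrightarrow> a \<bullet> b - F (x, a, t) \<le> R * \<bar>K\<bar> + B0)"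
    if x: "x \<in> cball x0 \<delta>" and t: "t \<in> cball t0 \<delta>" for x t
  proof (intro conjI allI impI)
    have F0: "\<bar>F (x, 0, t)\<bar> \<le> B0"
      using x t R by (intro B0) auto
    then show "\<bar>F (x, 0, t)\<bar> \<le> R * \<bar>K\<bar> + B0"
      using R by (intro order_trans[OF F0]) auto
    fix a b :: 'b
    assume b: "norm b \<le> K"
    have ab: "a \<bullet> b \<le> norm a * K"
      by (rule order_trans[OF norm_cauchy_schwarz]) (intro mult_left_mono b norm_ge_zero)
    show "a \<bullet> b - F (x, a, t) \<le> R * \<bar>K\<bar> + B0"
    proof (cases "norm a \<ge> R")
      case True
      have "a \<bullet> b - F (x, a, t) \<le> - F (x, 0, t)"
        using ab outer[rule_format, OF x t True] by (simp add: mult.commute)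
      also have "\<dots> \<le> R * \<bar>K\<bar> + B0"
        using F0 R mult_nonneg_nonneg[of R "\<bar>K\<bar>"] by linarith
      finally show ?thesis .
    next
      case False
      have "norm a * K \<le> norm a * \<bar>K\<bar>"
        by (intro mult_left_mono) auto
      also have "\<dots> \<le> R * \<bar>K\<bar>"
        using False by (intro mult_right_mono) auto
      finally have "norm a * K \<le> R * \<bar>K\<bar>" .
      then show ?thesis
        using ab B0[OF x _ t, of a] False by linarith
    qed
  qed
  with R show ?thesis
    by (intro that) blast+
qed

section \<open>Hamiltonian and Lagrangian in coordinates\<close>

definition hamiltonian_coord ::
    "('m, 'n::finite) chart set \<Rightarrow> ('m, 'n) hamiltonian \<Rightarrow> ('m, 'n) chart \<Rightarrow>
     (real ^ 'n) \<times> (real ^ 'n) \<times> real \<Rightarrow> real" where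
  "hamiltonian_coord A H c = (\<lambda>(x, a, t). H (chart_inv c x) (covec A c (chart_inv c x) a) (circ t))"

lemma smooth_on_hamiltonian_coord:
  "smooth_hamiltonian A H \<Longrightarrow> c \<in> A \<Longrightarrow> smooth_on (chart_img c \<times> UNIV \<times> UNIV) (hamiltonian_coord A H c)"
  by (simp add: smooth_hamiltonian_def hamiltonian_coord_def)

text \<open>Since \<open>covec\<close> is linear in the coordinates, the fibre Hessian of
  \<open>H\<close> is the second derivative of the coordinate expression.\<close>

lemma convex_on_hamiltonian_coord:
  assumes A: "smooth_atlas A" and H: "smooth_hamiltonian A H" "fibrewise_convex A H"
    and c: "c \<in> A" and x: "x \<in> chart_img c"
  shows "convex_on UNIV (\<lambda>a. hamiltonian_coord A H c (x, a, t))"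
proof (rule convex_on_fibre[OF smooth_atlas_chart(2)[OF A c] smooth_on_hamiltonian_coord[OF H(1) c] x])
  fix a e :: "real ^ 'b"
  assume e: "e \<noteq> 0"
  let ?q = "chart_inv c x"
  have q: "?q \<in> chart_dom c"
    using x by (rule chart_inv_in)
  \<comment> \<open>Pairing with the tangent vector of the same coordinates gives
    \<open>e \<bullet> e\<close>, so a nonzero \<open>e\<close> yields a nonzero covector, as strict
    convexity requires.\<close>
  have "covec A c ?q e (tvec A c ?q e) \<noteq> 0"
    using e by (simp add: covec_tvec[OF A c q])
  then have "covec A c ?q e \<noteq> (\<lambda>v. 0)"
    by metis
  then have "fibre_hessian H ?q (covec A c ?q a) (circ t) (covec A c ?q e) (covec A c ?q e) > 0"
    using H(2) covec_in_cotangent_space[OF A] unfolding fibrewise_convex_def by blast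
  then show "deriv (\<lambda>r. deriv (\<lambda>s. hamiltonian_coord A H c (x, a + r *\<^sub>R e + s *\<^sub>R e, t)) 0) 0 > 0"
    by (simp only: fibre_hessian_def hamiltonian_coord_def covec_add_scaleR prod.case)
qed

text \<open>The metric at \<open>q\<close> is bounded above by a multiple of the Euclidean one, so
  its unit ball contains a multiple of \<open>a\<close>; testing the covector on that multiple gives
  the estimate. The lower bound on the metric makes the supremum in \<open>dual_norm\<close> one of
  a bounded set.\<close>

lemma dual_norm_covec_ge:
  assumes A: "smooth_atlas A" and g: "riemannian_metric A g" and c: "c \<in> A" "q \<in> chart_dom c"
  obtains s where "s > 0" "\<forall>a. norm a \<le> s * dual_norm A g q (covec A c q a)"
proof -
  define Q where "Q a b = g q (tvec A c q a) (tvec A c q b)" for a b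
  have T: "tvec A c q a \<in> tangent_space A q" for a
    using tvec_in_tangent_space[OF A c] .
  have g_sym: "g q u w = g q w u" if "u \<in> tangent_space A q" "w \<in> tangent_space A q" for u w
    using g that unfolding riemannian_metric_def by blast
  have lin: "linear (Q a)" for a
    unfolding Q_def using g T by (intro linear_cotangent_tvec[OF A c]) (auto simp: riemannian_metric_def)
  have sym: "Q a b = Q b a" for a b
    unfolding Q_def by (intro g_sym T)
  have "bilinear Q"
    unfolding bilinear_def using lin sym by (auto simp: ext[OF sym])
  then interpret bounded_bilinear Q
    by (simp add: bilinear_conv_bounded_bilinear)
  have pos: "Q a a > 0" if "a \<noteq> 0" for a
  proof -
    have "tvec A c q a c \<noteq> 0"
      using that by (simp add: tvec_self[OF A c])
    then have "tvec A c q a \<noteq> (\<lambda>d. 0)"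
      by metis
    then show ?thesis
      using g T unfolding riemannian_metric_def Q_def by blast
  qed
  \<comment> \<open>The minimum of the quadratic form on the unit sphere is positive, so the unit
    ball of the metric is bounded in coordinates.\<close>
  have "\<exists>a\<in>sphere 0 1. \<forall>b\<in>sphere (0 :: real ^ 'b) 1. Q a a \<le> Q b b"
  proof (rule continuous_attains_inf)
    show "sphere (0 :: real ^ 'b) 1 \<noteq> {}"
      by simp
    show "continuous_on (sphere 0 1) (\<lambda>a. Q a a)"
      by (intro continuous_on continuous_on_id)
  qed simp
  then obtain a0 where a0: "norm a0 = 1" "\<And>b. norm b = 1 \<Longrightarrow> Q a0 a0 \<le> Q b b"
    by auto
  define m where "m = Q a0 a0"
  have "a0 \<noteq> 0"
    using a0(1) by auto
  then have m: "m > 0"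
    unfolding m_def by (rule pos)
  have lower: "m * (norm b)\<^sup>2 \<le> Q b b" for b
  proof (cases "b = 0")
    case False
    then have "m \<le> Q (b /\<^sub>R norm b) (b /\<^sub>R norm b)"
      unfolding m_def by (intro a0) simp
    also have "\<dots> = Q b b / (norm b)\<^sup>2"
      by (simp add: scaleR_left scaleR_right power2_eq_square divide_simps)
    finally show ?thesis
      using False by (simp add: field_simps)
  qed (simp add: zero_left)
  obtain M where M: "M > 0" "\<And>a b. norm (Q a b) \<le> norm a * norm b * M"
    using pos_bounded by blast
  let ?V = "{v \<in> tangent_space A q. g q v v \<le> 1}"
  have "norm a \<le> sqrt M * dual_norm A g q (covec A c q a)" for a
  proof -
    have "\<bar>covec A c q a v\<bar> \<le> norm a * sqrt (1 / m)" if v: "v \<in> ?V" for v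
    proof -
      have v_eq: "v = tvec A c q (v c)"
        using v tangent_space_eq_tvec[OF _ c] by blast
      have "m * (norm (v c))\<^sup>2 \<le> Q (v c) (v c)"
        by (rule lower)
      also have "\<dots> \<le> 1"
        unfolding Q_def v_eq[symmetric] using v by blast
      finally have "norm (v c) \<le> sqrt (1 / m)"
        using m by (intro real_le_rsqrt) (simp add: field_simps)
      then have "norm a * norm (v c) \<le> norm a * sqrt (1 / m)"
        by (intro mult_left_mono) auto
      moreover have "\<bar>a \<bullet> v c\<bar> \<le> norm a * norm (v c)"
        by (rule Cauchy_Schwarz_ineq2)
      moreover have "covec A c q a v = a \<bullet> v c"
        using v by (simp add: covec_def)
      ultimately show ?thesis
        by linarith
    qed
    then have bdd: "bdd_above ((\<lambda>v. \<bar>covec A c q a v\<bar>) ` ?V)"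
      by (intro bdd_aboveI2)
    \<comment> \<open>The multiple of \<open>a\<close> of Euclidean length
      \<open>1 / sqrt M\<close>, which lies in the unit ball of the metric. For \<open>a = 0\<close>
      division by zero makes it 0.\<close>
    define b where "b = (1 / (norm a * sqrt M)) *\<^sub>R a"
    have "Q b b \<le> norm b * norm b * M"
      using M(2)[of b b] by simp
    also have "\<dots> \<le> 1"
      using M(1) by (cases "a = 0") (simp_all add: b_def divide_simps)
    finally have "tvec A c q b \<in> ?V"
      using T by (simp add: Q_def)
    from cSUP_upper[OF this bdd] have ab: "\<bar>a \<bullet> b\<bar> \<le> dual_norm A g q (covec A c q a)"
      by (simp add: dual_norm_def covec_tvec[OF A c])
    have "norm a = sqrt M * (a \<bullet> b)"
      using M(1) by (cases "a = 0") (simp_all add: b_def dot_square_norm power2_eq_square)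
    also have "\<dots> \<le> sqrt M * dual_norm A g q (covec A c q a)"
      using ab M(1) by (intro mult_left_mono) auto
    finally show ?thesis .
  qed
  then show ?thesis
    using M(1) by (intro that[of "sqrt M"]) auto
qed

lemma superlinear_hamiltonian_coord:
  assumes A: "smooth_atlas A" and g: "riemannian_metric A g" and H: "fibrewise_superlinear A g H"
    and c: "c \<in> A" and x: "x \<in> chart_img c"
  shows "\<exists>R. \<forall>a. norm a \<ge> R \<longrightarrow> hamiltonian_coord A H c (x, a, t) \<ge> K * norm a"
proof -
  let ?q = "chart_inv c x"
  let ?N = "\<lambda>a. dual_norm A g ?q (covec A c ?q a)"
  obtain s where s: "s > 0" "\<forall>a. norm a \<le> s * ?N a"
    using dual_norm_covec_ge[OF A g c chart_inv_in[OF x]] .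
  \<comment> \<open>The factor \<open>s\<close> compensates for the change of norm, and the absolute
    value keeps the comparison monotone when \<open>K\<close> is negative.\<close>
  obtain R where R: "\<forall>p\<in>cotangent_space A ?q. dual_norm A g ?q p \<ge> R \<longrightarrow>
      H ?q p (circ t) \<ge> (\<bar>K\<bar> * s) * dual_norm A g ?q p"
    using H unfolding fibrewise_superlinear_def by blast
  have "hamiltonian_coord A H c (x, a, t) \<ge> K * norm a" if a: "norm a \<ge> s * R" for a
  proof -
    have "s * R \<le> s * ?N a"
      using a s(2) order_trans by blast
    then have "H ?q (covec A c ?q a) (circ t) \<ge> (\<bar>K\<bar> * s) * ?N a"
      using R s(1) covec_in_cotangent_space[OF A] by simp
    moreover have "K * norm a \<le> \<bar>K\<bar> * norm a"
      by (intro mult_right_mono) auto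
    moreover have "\<bar>K\<bar> * norm a \<le> \<bar>K\<bar> * (s * ?N a)"
      using s(2) by (intro mult_left_mono) auto
    ultimately show ?thesis
      by (simp add: hamiltonian_coord_def mult.assoc)
  qed
  then show ?thesis
    by blast
qed

lemma legendre_coord:
  assumes A: "smooth_atlas A" and c: "c \<in> A" "q \<in> chart_dom c" and v: "v \<in> tangent_space A q"
  shows "legendre A H q v (circ t) = (SUP a. a \<bullet> v c - hamiltonian_coord A H c (chart_map c q, a, t))"
  using v by (simp add: legendre_def cotangent_space_eq_range_covec[OF A c] image_image
      hamiltonian_coord_def chart_inv_map[OF A c] covec_def)

section \<open>Averaging over the circle\<close>

lemma circ_eq_iff: "circ t = circ u \<longleftrightarrow> t - u \<in> \<int>"
  by transfer simp

lemma rotate_circle_circ: "rotate_circle \<tau> (circ t) = circ (t + \<tau>)"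
  by transfer simp

text \<open>A section of \<open>circ\<close> with values in \<open>[0, 1)\<close>. It is
  discontinuous at \<open>circ 0\<close> but Borel, which is enough to read functions on the circle
  as periodic functions of a real phase.\<close>

lift_definition circle_rep :: "circle \<Rightarrow> real" is frac
  by (metis frac_add_int_right diff_add_cancel add.commute)

lemma circ_circle_rep [simp]: "circ (circle_rep s) = s"
  by transfer (simp add: frac_def)

lemma circle_rep_circ: "circle_rep (circ t) = frac t"
  by transfer simp

lemma circle_rep_bounds: "0 \<le> circle_rep s" "circle_rep s < 1"
  by (transfer, simp add: frac_lt_1)+

lemma open_circ_image:
  assumes "open U"
  shows "open (circ ` U)"
proof -
  have "circ -` (circ ` U) = (\<Union>k\<in>\<int>. (+) k ` U)"
  proof (intro equalityI subsetI)
    fix t assume "t \<in> circ -` (circ ` U)"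
    then obtain u where u: "u \<in> U" "t - u \<in> \<int>"
      by (auto simp: circ_eq_iff)
    then show "t \<in> (\<Union>k\<in>\<int>. (+) k ` U)"
      by (intro UN_I[of "t - u"] image_eqI[of _ _ u]) auto
  qed (auto intro!: imageI simp: circ_eq_iff image_iff; force simp: circ_eq_iff)
  then show ?thesis
    using assms by (auto simp: open_circle_def intro!: open_UN open_translation)
qed

text \<open>The representative is lower semicontinuous: its superlevel sets are images of open
  intervals ending at 1, or the whole circle.\<close>

lemma borel_measurable_circle_rep: "circle_rep \<in> borel_measurable borel"
proof (rule borel_measurableI_greater)
  fix y :: real
  have "{s. y < circle_rep s} = circ ` {y<..<1}" if "y \<ge> 0"
  proof (intro equalityI subsetI)
    show "s \<in> circ ` {y<..<1}" if "s \<in> {s. y < circle_rep s}" for s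
      using that circle_rep_bounds[of s] by (intro image_eqI[of _ _ "circle_rep s"]) auto
    show "s \<in> {s. y < circle_rep s}" if "s \<in> circ ` {y<..<1}" for s
      using that \<open>y \<ge> 0\<close> by (auto simp: circle_rep_circ)
  qed
  moreover have "{s. y < circle_rep s} = UNIV" if "y < 0"
    using that circle_rep_bounds(1) less_le_trans by blast
  ultimately have "open {s. y < circle_rep s}"
    using open_circ_image[of "{y<..<1}"] by (cases "y \<ge> 0") auto
  then show "{s \<in> space borel. y < circle_rep s} \<in> sets borel"
    by simp
qed

text \<open>The part of the shifted unit interval that sticks out beyond 1 is translated back by one
  period.\<close>

lemma integral_periodic:
  fixes h :: "real \<Rightarrow> real"
  assumes h: "\<And>a b. h integrable_on {a..b}" and per: "\<And>t. h (t + 1) = h t" and r: "0 \<le> r" "r \<le> 1"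
  shows "integral {0..1} (\<lambda>\<tau>. h (r + \<tau>)) = integral {0..1} h"
proof -
  have "integral {0..1} (\<lambda>\<tau>. h (r + \<tau>)) = integral {r..r + 1} h"
    using integral_shift_real_ivl[of r r "r + 1" h] by (simp add: add.commute)
  also have "\<dots> = integral {r..1} h + integral {1..r + 1} h"
    using r by (intro Henstock_Kurzweil_Integration.integral_combine[symmetric] h) auto
  also have "integral {1..r + 1} h = integral {0..r} h"
    using integral_shift_real_ivl[of 1 1 "r + 1" h] by (simp add: per)
  also have "integral {r..1} h + integral {0..r} h = integral {0..1} h"
    using r Henstock_Kurzweil_Integration.integral_combine[of 0 r 1 h] h by simp
  finally show ?thesis .
qed

text \<open>Invariance makes \<open>\<integral>x. h (r x + \<tau>) \<partial>\<mu>\<close>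
  independent of \<open>\<tau>\<close>. Averaging over \<open>\<tau>\<close> and exchanging the
  integrals leaves, for each \<open>x\<close>, the mean of \<open>h\<close> over one period. The
  hypothesis \<open>eq\<close> is stated after applying \<open>h\<close>, because a phase in a
  bounded interval can follow a rotation only modulo integers.\<close>

lemma integral_invariant_phase:
  fixes h :: "real \<Rightarrow> real"
  assumes \<mu>: "finite_measure \<mu>" "measure \<mu> (space \<mu>) = 1"
    and T: "\<And>\<tau>. T \<tau> \<in> measurable \<mu> \<mu>" "\<And>\<tau>. distr \<mu> \<mu> (T \<tau>) = \<mu>"
    and r: "r \<in> borel_measurable \<mu>" "\<And>x. 0 \<le> r x" "\<And>x. r x \<le> 1"
    and h: "h \<in> borel_measurable borel" "\<And>t. \<bar>h t\<bar> \<le> B" "\<And>t. h (t + 1) = h t"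
    and eq: "\<And>\<tau> x. h (r (T \<tau> x)) = h (r x + \<tau>)"
  shows "(\<integral>x. h (r x) \<partial>\<mu>) = integral {0..1} h"
proof -
  interpret \<mu>: finite_measure \<mu> by fact
  \<comment> \<open>Lebesgue measure on the unit interval has total mass 1. The product with
    \<open>\<mu>\<close> is therefore finite, and the bounded integrand is integrable as Fubini
    requires.\<close>
  define \<nu> where "\<nu> = restrict_space lborel {0..1::real}"
  have \<nu>_space: "measure \<nu> (space \<nu>) = 1"
    by (simp add: \<nu>_def measure_restrict_space space_restrict_space)
  interpret \<nu>: finite_measure \<nu>
    by (rule finite_measureI) (simp add: \<nu>_def emeasure_restrict_space space_restrict_space)
  interpret pair_sigma_finite \<mu> \<nu> ..
  interpret P: finite_measure "\<mu> \<Otimes>\<^sub>M \<nu>"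
    by (intro finite_measure_pair_measure) unfold_locales
  have id: "(\<lambda>\<tau>. \<tau>) \<in> borel_measurable \<nu>"
    unfolding \<nu>_def by (intro measurable_restrict_space1) simp
  have [measurable]: "r \<in> borel_measurable \<mu>" "h \<in> borel_measurable borel" "(\<lambda>\<tau>. \<tau>) \<in> borel_measurable \<nu>"
    by fact+
  have snd_m [measurable]: "snd \<in> borel_measurable (\<mu> \<Otimes>\<^sub>M \<nu>)"
    using measurable_compose[OF measurable_snd id] by simp
  have hk: "h integrable_on {a..b}" for a b
  proof -
    have "set_integrable lborel {a..b} h"
      unfolding set_integrable_def
      by (intro integrableI_bounded_set_indicator[where B = B]) (use h in \<open>auto simp: emeasure_lborel_Icc_eq\<close>)
    then show ?thesis
      by (rule set_borel_integral_eq_integral)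
  qed
  have const: "(\<integral>x. h (r x + \<tau>) \<partial>\<mu>) = (\<integral>x. h (r x) \<partial>\<mu>)" for \<tau>
  proof -
    have "(\<integral>x. h (r x) \<partial>\<mu>) = (\<integral>x. h (r x) \<partial>distr \<mu> \<mu> (T \<tau>))"
      by (simp only: T(2))
    also have "\<dots> = (\<integral>x. h (r (T \<tau> x)) \<partial>\<mu>)"
      by (intro integral_distr T(1)) measurable
    finally show ?thesis
      by (simp only: eq)
  qed
  have "integrable (\<mu> \<Otimes>\<^sub>M \<nu>) (case_prod (\<lambda>x \<tau>. h (r x + \<tau>)))"
    unfolding case_prod_beta using h(2) by (intro P.integrable_const_bound[where B = B]) auto
  then have "(\<integral>\<tau>. (\<integral>x. h (r x + \<tau>) \<partial>\<mu>) \<partial>\<nu>) = (\<integral>x. (\<integral>\<tau>. h (r x + \<tau>) \<partial>\<nu>) \<partial>\<mu>)"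
    by (rule Fubini_integral)
  moreover have "(\<integral>\<tau>. h (r x + \<tau>) \<partial>\<nu>) = integral {0..1} h" for x
  proof -
    have "(\<integral>\<tau>. h (r x + \<tau>) \<partial>\<nu>) = (LINT \<tau>:{0..1}|lborel. h (r x + \<tau>))"
      unfolding \<nu>_def set_lebesgue_integral_def by (rule integral_restrict_space) simp
    also have "\<dots> = integral {0..1} (\<lambda>\<tau>. h (r x + \<tau>))"
      by (intro set_borel_integral_eq_integral, unfold set_integrable_def)
        (intro integrableI_bounded_set_indicator[where B = B], use h in \<open>auto simp: emeasure_lborel_Icc_eq\<close>)
    also have "\<dots> = integral {0..1} h"
      by (intro integral_periodic hk h r)
    finally show ?thesis .
  qed
  ultimately show ?thesis
    using \<mu>(2) \<nu>_space by (simp add: const)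
qed

text \<open>Periodicity reduces the bound to a compact product. A supremum of continuous functions
  is lower semicontinuous: its strict superlevel sets are unions of open ones.\<close>

lemma periodic_sup:
  fixes \<Phi> :: "'m::topological_space \<times> real \<Rightarrow> real"
  assumes M: "compact (UNIV :: 'm set)" and cont: "continuous_on UNIV \<Phi>"
    and per: "\<And>q t k. k \<in> \<int> \<Longrightarrow> \<Phi> (q, t + k) = \<Phi> (q, t)"
  obtains B where "\<forall>q t. \<bar>\<Phi> (q, t)\<bar> \<le> B" "(\<lambda>t. SUP q. \<Phi> (q, t)) \<in> borel_measurable borel"
proof -
  have "bounded (\<Phi> ` (UNIV \<times> {0..1}))"
    by (intro compact_imp_bounded compact_continuous_image compact_Times M continuous_on_subset[OF cont]) auto
  then obtain B where B: "\<forall>y\<in>\<Phi> ` (UNIV \<times> {0..1}). norm y \<le> B"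
    unfolding bounded_iff by blast
  have bound: "\<bar>\<Phi> (q, t)\<bar> \<le> B" for q t
  proof -
    have "\<Phi> (q, t) = \<Phi> (q, frac t)"
      using per[of "of_int \<lfloor>t\<rfloor>" q "frac t"] by (simp add: frac_def)
    moreover have "norm (\<Phi> (q, frac t)) \<le> B"
      using frac_lt_1[of t] by (intro bspec[OF B] imageI) auto
    ultimately show ?thesis
      by simp
  qed
  have "open {t. y < (SUP q. \<Phi> (q, t))}" for y
  proof -
    have "bdd_above (range (\<lambda>q. \<Phi> (q, t)))" for t
      using bound by (intro bdd_aboveI2[of _ _ B]) (meson abs_le_D1)
    then have "{t. y < (SUP q. \<Phi> (q, t))} = (\<Union>q. {t. y < \<Phi> (q, t)})"
      by (auto simp: less_cSUP_iff)
    moreover have "open {t. y < \<Phi> (q, t)}" for q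
      by (intro open_Collect_less continuous_intros continuous_on_compose2[OF cont]) auto
    ultimately show ?thesis
      by auto
  qed
  then have "(\<lambda>t. SUP q. \<Phi> (q, t)) \<in> borel_measurable borel"
    by (intro borel_measurableI_greater) simp
  with bound show ?thesis
    by (intro that) auto
qed

section \<open>Functions on the phase space given in coordinates\<close>

lemma topspace_phase_topology:
  assumes "smooth_atlas A"
  shows "topspace (phase_topology A) = tangent_bundle A \<times> UNIV"
proof -
  have "topspace (tangent_bundle_topology A) = tangent_bundle A"
    unfolding tangent_bundle_topology_def topology_generated_by_topspace
  proof (intro equalityI subsetI)
    fix z assume z: "z \<in> tangent_bundle A"
    obtain c where "c \<in> A" "fst z \<in> chart_dom c"
      using assms smooth_atlas_cover by blast
    with z show "z \<in> \<Union>{{(q, v) \<in> tangent_bundle A. q \<in> chart_dom c \<and> (chart_map c q, v c) \<in> W} | c W.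
        c \<in> A \<and> open W}"
      by (intro UnionI[of "{(q, v) \<in> tangent_bundle A. q \<in> chart_dom c \<and> (chart_map c q, v c) \<in> UNIV}"])
        (blast, auto)
  qed blast
  then show ?thesis
    by (simp add: phase_topology_def)
qed

text \<open>The coordinate neighbourhoods of phase space. Time is determined only modulo 1, so a
  phase point belongs to the set as soon as one real lift of its time fits.\<close>

definition phase_chart_set ::
    "('m, 'n::finite) chart set \<Rightarrow> ('m, 'n) chart \<Rightarrow> ((real ^ 'n) \<times> (real ^ 'n) \<times> real) set \<Rightarrow>
     (('m \<times> ('m, 'n) tangent) \<times> circle) set" where
  "phase_chart_set A c V =
     {((q, v), circ t) | q v t. v \<in> tangent_space A q \<and> q \<in> chart_dom c \<and> (chart_map c q, v c, t) \<in> V}"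

text \<open>Around each point, \<open>V\<close> contains a box that splits into a generating set of
  the tangent bundle topology and a time set; \<open>circ\<close> maps the latter to an open
  set.\<close>

lemma openin_phase_chart_set:
  assumes c: "c \<in> A" and V: "open V"
  shows "openin (phase_topology A) (phase_chart_set A c V)"
proof (subst openin_subopen, intro ballI)
  fix z assume "z \<in> phase_chart_set A c V"
  then obtain q v t where z: "z = ((q, v), circ t)" "v \<in> tangent_space A q" "q \<in> chart_dom c"
      "(chart_map c q, v c, t) \<in> V"
    by (auto simp: phase_chart_set_def)
  obtain X Y where XY: "open X" "open Y" "(chart_map c q, v c, t) \<in> X \<times> Y" "X \<times> Y \<subseteq> V"
    by (rule open_prod_elim[OF V z(4)])
  have "(v c, t) \<in> Y"
    using XY(3) by simp
  then obtain Y' I where YI: "open Y'" "open I" "(v c, t) \<in> Y' \<times> I" "Y' \<times> I \<subseteq> Y"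
    by (rule open_prod_elim[OF XY(2)])
  let ?W = "{(q, v) \<in> tangent_bundle A. q \<in> chart_dom c \<and> (chart_map c q, v c) \<in> X \<times> Y'}"
  have "openin (tangent_bundle_topology A) ?W"
    unfolding tangent_bundle_topology_def
    by (rule topology_generated_by_Basis, rule CollectI, rule exI[of _ c], rule exI[of _ "X \<times> Y'"])
      (intro conjI refl c open_Times XY(1) YI(1))
  then have "openin (phase_topology A) (?W \<times> circ ` I)"
    using YI open_circ_image[of I] by (simp add: phase_topology_def openin_prod_Times_iff)
  moreover have "z \<in> ?W \<times> circ ` I"
    using z XY YI by (simp add: tangent_bundle_def)
  moreover have "?W \<times> circ ` I \<subseteq> phase_chart_set A c V"
    using XY(4) YI(4) unfolding phase_chart_set_def tangent_bundle_def by blast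
  ultimately show "\<exists>T. openin (phase_topology A) T \<and> z \<in> T \<and> T \<subseteq> phase_chart_set A c V"
    by blast
qed

text \<open>Strict superlevel sets are unions of coordinate neighbourhoods. The union runs over an
  atlas of any cardinality, so its measurability comes from openness rather than from countable
  unions.\<close>

lemma borel_measurable_phaseI:
  fixes f :: "('m::t2_space \<times> ('m, 'n::finite) tangent) \<times> circle \<Rightarrow> real"
  assumes A: "smooth_atlas A"
    and \<mu>: "sets \<mu> = sets (sigma (topspace (phase_topology A)) {U. openin (phase_topology A) U})"
    and rep: "\<And>c q v t. c \<in> A \<Longrightarrow> q \<in> chart_dom c \<Longrightarrow> v \<in> tangent_space A q \<Longrightarrow>
      f ((q, v), circ t) = F c (chart_map c q, v c, t)"
    and F: "\<And>c y. c \<in> A \<Longrightarrow> open {z \<in> chart_img c \<times> UNIV \<times> UNIV. y < F c z}"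
  shows "f \<in> borel_measurable \<mu>"
proof (rule borel_measurableI_greater)
  fix y
  let ?P = "phase_topology A"
  let ?V = "\<lambda>c. {z \<in> chart_img c \<times> UNIV \<times> UNIV. y < F c z}"
  have sub: "{U. openin ?P U} \<subseteq> Pow (topspace ?P)"
    by (auto dest: openin_subset)
  have space: "space \<mu> = tangent_bundle A \<times> UNIV"
    using sets_eq_imp_space_eq[OF \<mu>] sub by (simp add: topspace_phase_topology[OF A])
  have "{x \<in> space \<mu>. y < f x} = (\<Union>c\<in>A. phase_chart_set A c (?V c))"
  proof (intro equalityI subsetI)
    fix x assume x: "x \<in> {x \<in> space \<mu>. y < f x}"
    obtain q v s where x_eq: "x = ((q, v), circ (circle_rep s))"
      by (cases x) auto
    obtain c where c: "c \<in> A" "q \<in> chart_dom c"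
      using A smooth_atlas_cover by blast
    have v: "v \<in> tangent_space A q"
      using x by (simp add: space x_eq tangent_bundle_def)
    have "(chart_map c q, v c, circle_rep s) \<in> ?V c"
      using x rep[OF c v, of "circle_rep s"] c(2) by (simp add: x_eq chart_map_in)
    with c v show "x \<in> (\<Union>c\<in>A. phase_chart_set A c (?V c))"
      unfolding phase_chart_set_def x_eq by blast
  next
    fix x assume "x \<in> (\<Union>c\<in>A. phase_chart_set A c (?V c))"
    then obtain c q v t where c: "c \<in> A" and x: "x = ((q, v), circ t)" "v \<in> tangent_space A q"
        "q \<in> chart_dom c" "(chart_map c q, v c, t) \<in> ?V c"
      unfolding phase_chart_set_def by blast
    then show "x \<in> {x \<in> space \<mu>. y < f x}"
      using rep[OF c x(3,2)] by (simp add: space tangent_bundle_def)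
  qed
  moreover have "openin ?P (\<Union>c\<in>A. phase_chart_set A c (?V c))"
    using openin_phase_chart_set[OF _ F] by (intro openin_clauses(3)) blast
  ultimately show "{x \<in> space \<mu>. y < f x} \<in> sets \<mu>"
    unfolding \<mu> using sub by (auto simp: sets_measure_of)
qed

text \<open>Local bounds in coordinates hold on open sets of phase space, finitely many of which
  cover \<open>K\<close>.\<close>

lemma bounded_on_compact_phase:
  fixes f :: "('m::t2_space \<times> ('m, 'n::finite) tangent) \<times> circle \<Rightarrow> real"
  assumes A: "smooth_atlas A" and K: "compactin (phase_topology A) K"
    and rep: "\<And>c q v t. c \<in> A \<Longrightarrow> q \<in> chart_dom c \<Longrightarrow> v \<in> tangent_space A q \<Longrightarrow>
      f ((q, v), circ t) = F c (chart_map c q, v c, t)"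
    and F: "\<And>c z. c \<in> A \<Longrightarrow> z \<in> chart_img c \<times> UNIV \<times> UNIV \<Longrightarrow>
      \<exists>V B. open V \<and> z \<in> V \<and> (\<forall>y\<in>V. \<bar>F c y\<bar> \<le> B)"
  obtains B where "\<forall>x\<in>K. \<bar>f x\<bar> \<le> B"
proof -
  define \<U> where "\<U> = {U. openin (phase_topology A) U \<and> (\<exists>B. \<forall>x\<in>U. \<bar>f x\<bar> \<le> B)}"
  have cover: "K \<subseteq> \<Union>\<U>"
  proof
    fix x assume "x \<in> K"
    then have x: "x \<in> tangent_bundle A \<times> UNIV"
      using compactin_subset_topspace[OF K] topspace_phase_topology[OF A] by blast
    obtain q v s where x_eq: "x = ((q, v), circ (circle_rep s))"
      by (cases x) auto
    obtain c where c: "c \<in> A" "q \<in> chart_dom c"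
      using A smooth_atlas_cover by blast
    have "(chart_map c q, v c, circle_rep s) \<in> chart_img c \<times> UNIV \<times> UNIV"
      using c by (simp add: chart_map_in)
    from F[OF c(1) this] obtain V B where V: "open V" "(chart_map c q, v c, circle_rep s) \<in> V"
        "\<forall>y\<in>V. \<bar>F c y\<bar> \<le> B"
      by blast
    have "\<forall>x\<in>phase_chart_set A c V. \<bar>f x\<bar> \<le> B"
      unfolding phase_chart_set_def using rep[OF c(1)] V(3) by auto
    then have "phase_chart_set A c V \<in> \<U>"
      unfolding \<U>_def using openin_phase_chart_set[OF c(1) V(1)] by blast
    moreover have "x \<in> phase_chart_set A c V"
      using x c V(2) unfolding phase_chart_set_def x_eq tangent_bundle_def by blast
    ultimately show "x \<in> \<Union>\<U>"
      by blast
  qed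
  have "openin (phase_topology A) U" if "U \<in> \<U>" for U
    using that by (simp add: \<U>_def)
  from compactinD[OF K this cover]
  obtain \<F> where \<F>: "finite \<F>" "\<F> \<subseteq> \<U>" "K \<subseteq> \<Union>\<F>"
    by blast
  from \<F>(1,2) have "\<exists>B. \<forall>x\<in>\<Union>\<F>. \<bar>f x\<bar> \<le> B"
  proof (induction)
    case (insert U \<F>)
    have "\<F> \<subseteq> \<U>" "U \<in> \<U>"
      using insert.prems by simp_all
    from insert.IH[OF this(1)] obtain B where "\<forall>x\<in>\<Union>\<F>. \<bar>f x\<bar> \<le> B"
      by (rule exE)
    moreover from \<open>U \<in> \<U>\<close> obtain B' where "\<forall>x\<in>U. \<bar>f x\<bar> \<le> B'"
      unfolding \<U>_def mem_Collect_eq by (elim conjE exE)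
    ultimately have "\<forall>x\<in>\<Union>(insert U \<F>). \<bar>f x\<bar> \<le> max B B'"
      by (auto simp: max.coboundedI1 max.coboundedI2)
    then show ?case
      by (rule exI)
  qed simp
  then obtain B where "\<forall>x\<in>\<Union>\<F>. \<bar>f x\<bar> \<le> B"
    by (rule exE)
  with \<F>(3) have "\<forall>x\<in>K. \<bar>f x\<bar> \<le> B"
    by (meson subsetD)
  then show ?thesis
    by (rule that)
qed

text \<open>The function is measurable by lower semicontinuity and almost everywhere bounded,
  because the finite measure is carried by a compact set.\<close>

lemma integrable_phaseI:
  fixes f :: "('m::t2_space \<times> ('m, 'n::finite) tangent) \<times> circle \<Rightarrow> real"
  assumes A: "smooth_atlas A" and \<mu>: "\<mu> \<in> invariant_measures A L"
    and rep: "\<And>c q v t. c \<in> A \<Longrightarrow> q \<in> chart_dom c \<Longrightarrow> v \<in> tangent_space A q \<Longrightarrow>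
      f ((q, v), circ t) = F c (chart_map c q, v c, t)"
    and F: "\<And>c y. c \<in> A \<Longrightarrow> open {z \<in> chart_img c \<times> UNIV \<times> UNIV. y < F c z}"
      "\<And>c z. c \<in> A \<Longrightarrow> z \<in> chart_img c \<times> UNIV \<times> UNIV \<Longrightarrow>
        \<exists>V B. open V \<and> z \<in> V \<and> (\<forall>y\<in>V. \<bar>F c y\<bar> \<le> B)"
  shows "integrable \<mu> f"
proof -
  interpret finite_measure \<mu>
    using \<mu> by (intro finite_measureI) (simp add: invariant_measures_def)
  obtain K where K: "compactin (phase_topology A) K" "AE x in \<mu>. x \<in> K"
    using \<mu> by (auto simp: invariant_measures_def)
  obtain B where B: "\<forall>x\<in>K. \<bar>f x\<bar> \<le> B"
    using bounded_on_compact_phase[OF A K(1) rep F(2)] by blast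
  show ?thesis
  proof (rule integrable_const_bound)
    show "AE x in \<mu>. norm (f x) \<le> B"
      using K(2) by eventually_elim (use B in auto)
    show "f \<in> borel_measurable \<mu>"
      using \<mu> by (intro borel_measurable_phaseI[OF A _ rep F(1)]) (auto simp: invariant_measures_def)
  qed
qed

section \<open>Closed 1-forms as integrable functions on phase space\<close>

lemma closed_1form_coord:
  assumes "smooth_atlas A" "c \<in> A" "q \<in> chart_dom c" "closed_1form A \<theta>"
  shows "\<theta> q = covec A c q (form_coord A c \<theta> (chart_map c q))"
  using closed_1form_eq_covec[OF assms(1,2) chart_map_in[OF assms(3)] assms(4)]
  by (simp add: chart_inv_map[OF assms(1-3)])

lemma integrable_closed_1form:
  assumes A: "smooth_atlas A" and \<mu>: "\<mu> \<in> invariant_measures A L" and \<theta>: "closed_1form A \<theta>"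
  shows "integrable \<mu> (\<lambda>((q, v), s). \<theta> q v)"
proof (rule integrable_phaseI[OF A \<mu>, where F = "\<lambda>c (x, b, t). form_coord A c \<theta> x \<bullet> b"])
  fix c q v t
  assume c: "c \<in> A" "q \<in> chart_dom c" "v \<in> tangent_space A q"
  show "(\<lambda>((q, v), s). \<theta> q v) ((q, v), circ t) =
      (\<lambda>(x, b, t). form_coord A c \<theta> x \<bullet> b) (chart_map c q, v c, t)"
    using c(3) by (simp add: closed_1form_coord[OF A c(1,2) \<theta>] covec_def)
next
  fix c assume c: "c \<in> A"
  let ?S = "chart_img c \<times> (UNIV :: (real ^ 'b) set) \<times> (UNIV :: real set)"
  let ?F = "\<lambda>(x, b, t::real). form_coord A c \<theta> x \<bullet> b"
  have S: "open ?S"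
    by (intro open_Times smooth_atlas_chart(2)[OF A c] open_UNIV)
  have "continuous_on (chart_img c) (form_coord A c \<theta>)"
    using \<theta> c smooth_on_imp_continuous_on unfolding closed_1form_def by blast
  then have "continuous_on ?S (\<lambda>z. form_coord A c \<theta> (fst z))"
    by (rule continuous_on_compose2[OF _ continuous_on_fst[OF continuous_on_id]]) auto
  then have cont: "continuous_on ?S ?F"
    unfolding case_prod_beta by (intro continuous_intros)
  show "open {z \<in> ?S. y < ?F z}" for y
    using continuous_open_preimage[OF cont S open_greaterThan[of y]]
    by (simp add: Int_def vimage_def)
  show "\<exists>V B. open V \<and> z \<in> V \<and> (\<forall>y\<in>V. \<bar>?F y\<bar> \<le> B)" if z: "z \<in> ?S" for z
  proof (intro exI conjI)
    show "open (?S \<inter> ?F -` ball (?F z) 1)"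
      by (rule continuous_open_preimage[OF cont S open_ball])
    show "z \<in> ?S \<inter> ?F -` ball (?F z) 1"
      using z by simp
    show "\<forall>y\<in>?S \<inter> ?F -` ball (?F z) 1. \<bar>?F y\<bar> \<le> \<bar>?F z\<bar> + 1"
      by (auto simp: dist_real_def)
  qed
qed

section \<open>Integrating the Fenchel inequality\<close>

locale convex_superlinear_hamiltonian =
  fixes A :: "('m::t2_space, 'n::finite) chart set"
    and g :: "('m, 'n) metric"
    and H :: "('m, 'n) hamiltonian"
  assumes A: "smooth_atlas A"
    and g: "riemannian_metric A g"
    and smooth: "smooth_hamiltonian A H"
    and conv: "fibrewise_convex A H"
    and superlin: "fibrewise_superlinear A g H"
begin

lemma locally_bounded:
  assumes c: "c \<in> A" and x0: "x0 \<in> chart_img c"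
  obtains \<delta> B where "\<delta> > 0" "cball x0 \<delta> \<subseteq> chart_img c"
    "\<forall>x\<in>cball x0 \<delta>. \<forall>t\<in>cball t0 \<delta>. \<bar>hamiltonian_coord A H c (x, 0, t)\<bar> \<le> B \<and>
       (\<forall>a b. norm b \<le> K \<longrightarrow> a \<bullet> b - hamiltonian_coord A H c (x, a, t) \<le> B)"
  by (rule legendre_locally_bounded[OF smooth_atlas_chart(2)[OF A c]
        smooth_on_imp_continuous_on[OF smooth_on_hamiltonian_coord[OF smooth c]] x0
        convex_on_hamiltonian_coord[OF A smooth conv c]
        superlinear_hamiltonian_coord[OF A g superlin c x0]])

text \<open>A real \<open>SUP\<close> is meaningful only for sets bounded above; this legitimises
  the manipulations of the Legendre transform below.\<close>

lemma bdd_above_legendre: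
  assumes c: "c \<in> A" and x: "x \<in> chart_img c"
  shows "bdd_above (range (\<lambda>a. a \<bullet> b - hamiltonian_coord A H c (x, a, t)))"
proof -
  obtain \<delta> B where \<delta>: "\<delta> > 0"
    and B: "\<forall>x'\<in>cball x \<delta>. \<forall>t'\<in>cball t \<delta>. \<bar>hamiltonian_coord A H c (x', 0, t')\<bar> \<le> B \<and>
       (\<forall>a b'. norm b' \<le> norm b \<longrightarrow> a \<bullet> b' - hamiltonian_coord A H c (x', a, t') \<le> B)"
    by (rule locally_bounded[OF c x])
  show ?thesis
    using \<delta> bspec[OF bspec[OF B, of x], of t] by (intro bdd_aboveI2[of _ _ B]) auto
qed

text \<open>In coordinates the Lagrangian is a supremum of continuous functions of
  \<open>(x, b, t)\<close>, hence lower semicontinuous, and it is locally bounded from both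
  sides.\<close>

lemma integrable_legendre:
  assumes \<mu>: "\<mu> \<in> invariant_measures A L"
  shows "integrable \<mu> (\<lambda>((q, v), s). legendre A H q v s)"
proof (rule integrable_phaseI[OF A \<mu>,
      where F = "\<lambda>c (x, b, t). SUP a. a \<bullet> b - hamiltonian_coord A H c (x, a, t)"])
  fix c q v t
  assume "c \<in> A" "q \<in> chart_dom c" "v \<in> tangent_space A q"
  from legendre_coord[OF A this]
  show "(\<lambda>((q, v), s). legendre A H q v s) ((q, v), circ t) =
      (\<lambda>(x, b, t). SUP a. a \<bullet> b - hamiltonian_coord A H c (x, a, t)) (chart_map c q, v c, t)"
    by simp
next
  fix c assume c: "c \<in> A"
  let ?S = "chart_img c \<times> (UNIV :: (real ^ 'n) set) \<times> (UNIV :: real set)"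
  let ?G = "\<lambda>a (x, b, t). a \<bullet> b - hamiltonian_coord A H c (x, a, t)"
  let ?F = "\<lambda>(x, b, t). SUP a. a \<bullet> b - hamiltonian_coord A H c (x, a, t)"
  have S: "open ?S"
    by (intro open_Times smooth_atlas_chart(2)[OF A c] open_UNIV)
  have "continuous_on ?S (hamiltonian_coord A H c)"
    by (rule smooth_on_imp_continuous_on[OF smooth_on_hamiltonian_coord[OF smooth c]])
  then have "continuous_on ?S (\<lambda>z. hamiltonian_coord A H c (fst z, a, snd (snd z)))" for a
    by (rule continuous_on_compose2) (intro continuous_intros, auto)
  then have cont: "continuous_on ?S (?G a)" for a
    unfolding case_prod_beta by (intro continuous_intros)
  show "open {z \<in> ?S. y < ?F z}" for y
  proof -
    have "{z \<in> ?S. y < ?F z} = (\<Union>a. ?S \<inter> ?G a -` {y<..})"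
      using bdd_above_legendre[OF c] by (auto simp: less_cSUP_iff)
    moreover have "open (\<Union>a. ?S \<inter> ?G a -` {y<..})"
      by (intro open_UN ballI continuous_open_preimage[OF cont S open_greaterThan])
    ultimately show ?thesis
      by (simp only:)
  qed
  show "\<exists>V B. open V \<and> z \<in> V \<and> (\<forall>y\<in>V. \<bar>?F y\<bar> \<le> B)" if z: "z \<in> ?S" for z
  proof -
    obtain x0 b0 t0 where z_eq: "z = (x0, b0, t0)"
      by (cases z)
    then have x0: "x0 \<in> chart_img c"
      using z by simp
    \<comment> \<open>The velocity bound \<open>norm b0 + 1\<close> covers the unit ball around
      \<open>b0\<close>.\<close>
    obtain \<delta> B where \<delta>: "\<delta> > 0" "cball x0 \<delta> \<subseteq> chart_img c"
      and B: "\<forall>x\<in>cball x0 \<delta>. \<forall>t\<in>cball t0 \<delta>. \<bar>hamiltonian_coord A H c (x, 0, t)\<bar> \<le> B \<and>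
       (\<forall>a b. norm b \<le> norm b0 + 1 \<longrightarrow> a \<bullet> b - hamiltonian_coord A H c (x, a, t) \<le> B)"
      by (rule locally_bounded[OF c x0])
    have "\<bar>?F y\<bar> \<le> B" if y_in: "y \<in> ball x0 \<delta> \<times> ball b0 1 \<times> ball t0 \<delta>" for y
    proof -
      obtain x b t where y: "y = (x, b, t)" "x \<in> cball x0 \<delta>" "t \<in> cball t0 \<delta>" "dist b0 b < 1"
        using y_in by (cases y) auto
      have "norm b \<le> norm b0 + 1"
        using y(4) norm_triangle_ineq2[of b b0] by (simp add: dist_norm norm_minus_commute)
      with B y have upper: "a \<bullet> b - hamiltonian_coord A H c (x, a, t) \<le> B" for a
        by blast
      have "- B \<le> 0 \<bullet> b - hamiltonian_coord A H c (x, 0, t)"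
        using B y(2,3) by fastforce
      also have "\<dots> \<le> ?F y"
        unfolding y(1) prod.case using bdd_above_legendre[OF c] y(2) \<delta>(2)
        by (intro cSUP_upper) auto
      finally have "- B \<le> ?F y" .
      moreover have "?F y \<le> B"
        unfolding y(1) prod.case by (intro cSUP_least upper) auto
      ultimately show ?thesis
        by linarith
    qed
    moreover have "open (ball x0 \<delta> \<times> ball b0 1 \<times> ball t0 \<delta>)"
      by (intro open_Times open_ball)
    moreover have "z \<in> ball x0 \<delta> \<times> ball b0 1 \<times> ball t0 \<delta>"
      using \<delta> by (simp add: z_eq)
    ultimately show ?thesis
      by blast
  qed
qed

lemma hamiltonian_on_form:
  assumes \<theta>: "closed_1form A \<theta>" and c: "c \<in> A" "q \<in> chart_dom c"
  shows "H q (\<theta> q) (circ t) =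
    hamiltonian_coord A H c (chart_map c q, form_coord A c \<theta> (chart_map c q), t)"
  by (simp add: hamiltonian_coord_def chart_inv_map[OF A c] flip: closed_1form_coord[OF A c \<theta>])

lemma fenchel_inequality:
  assumes \<theta>: "closed_1form A \<theta>" and v: "v \<in> tangent_space A q"
  shows "\<theta> q v - H q (\<theta> q) (circ t) \<le> legendre A H q v (circ t)"
proof -
  obtain c where c: "c \<in> A" "q \<in> chart_dom c"
    using A smooth_atlas_cover by blast
  have "\<theta> q v = form_coord A c \<theta> (chart_map c q) \<bullet> v c"
    using v by (simp add: closed_1form_coord[OF A c \<theta>] covec_def)
  then show ?thesis
    unfolding hamiltonian_on_form[OF \<theta> c] legendre_coord[OF A c v]
    by (simp only:) (rule cSUP_upper[OF UNIV_I bdd_above_legendre[OF c(1) chart_map_in[OF c(2)]]])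
qed

text \<open>Continuity is local, and on each chart domain the function is a composition of
  continuous coordinate expressions.\<close>

lemma continuous_on_hamiltonian_on_form:
  assumes \<theta>: "closed_1form A \<theta>"
  shows "continuous_on UNIV (\<lambda>(q, t). H q (\<theta> q) (circ t))"
proof -
  let ?\<Phi> = "\<lambda>(q, t). H q (\<theta> q) (circ t)"
  have "continuous_on (\<Union>c\<in>A. chart_dom c \<times> UNIV) ?\<Phi>"
  proof (rule continuous_on_open_UN)
    fix c assume c: "c \<in> A"
    show "open (chart_dom c \<times> (UNIV :: real set))"
      by (intro open_Times smooth_atlas_chart(1)[OF A c] open_UNIV)
    have "continuous_on (chart_dom c) (chart_map c)"
      using smooth_atlas_chart(3)[OF A c] by (simp add: homeomorphism_def)
    then have x: "continuous_on (chart_dom c \<times> (UNIV :: real set)) (\<lambda>z. chart_map c (fst z))"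
      by (rule continuous_on_compose2[OF _ continuous_on_fst[OF continuous_on_id]]) auto
    have "continuous_on (chart_img c) (form_coord A c \<theta>)"
      using \<theta> c smooth_on_imp_continuous_on unfolding closed_1form_def by blast
    then have a: "continuous_on (chart_dom c \<times> (UNIV :: real set)) (\<lambda>z. form_coord A c \<theta> (chart_map c (fst z)))"
      by (rule continuous_on_compose2[OF _ x]) (auto simp: chart_map_in)
    have "continuous_on (chart_dom c \<times> UNIV)
        (\<lambda>z. hamiltonian_coord A H c (chart_map c (fst z), form_coord A c \<theta> (chart_map c (fst z)), snd z))"
      by (rule continuous_on_compose2[OF smooth_on_imp_continuous_on[OF smooth_on_hamiltonian_coord[OF smooth c]]
            continuous_on_Pair[OF x continuous_on_Pair[OF a continuous_on_snd[OF continuous_on_id]]]])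
        (auto simp: chart_map_in)
    then show "continuous_on (chart_dom c \<times> UNIV) ?\<Phi>"
      by (rule continuous_on_eq) (auto simp: hamiltonian_on_form[OF \<theta> c])
  qed
  moreover have "z \<in> (\<Union>c\<in>A. chart_dom c \<times> (UNIV :: real set))" for z
  proof -
    obtain c where "c \<in> A" "fst z \<in> chart_dom c"
      using A smooth_atlas_cover by blast
    then show ?thesis
      by (intro UN_I[of c]) (auto simp: mem_Times_iff)
  qed
  then have "(\<Union>c\<in>A. chart_dom c \<times> (UNIV :: real set)) = UNIV"
    by (rule UNIV_eq_I[symmetric])
  ultimately show ?thesis
    by (simp only:)
qed

lemma integral_legendre_ge:
  assumes M: "compact (UNIV :: 'm set)"
    and \<mu>: "\<mu> \<in> invariant_measures A L" and \<theta>: "closed_1form A \<theta>"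
  shows "(\<integral>((q, v), s). \<theta> q v \<partial>\<mu>) - integral {0..1} (\<lambda>t. SUP q. H q (\<theta> q) (circ t)) \<le>
    (\<integral>((q, v), s). legendre A H q v s \<partial>\<mu>)"
proof -
  define h where "h t = (SUP q. H q (\<theta> q) (circ t))" for t
  have circ_add: "circ (t + k) = circ t" if "k \<in> \<int>" for t k
    using that by (simp add: circ_eq_iff)
  let ?\<Phi> = "\<lambda>(q, t). H q (\<theta> q) (circ t)"
  obtain B where "\<forall>q t. \<bar>?\<Phi> (q, t)\<bar> \<le> B" "(\<lambda>t. SUP q. ?\<Phi> (q, t)) \<in> borel_measurable borel"
    by (rule periodic_sup[OF M continuous_on_hamiltonian_on_form[OF \<theta>]]) (simp add: circ_add)
  then have B: "\<And>q t. \<bar>H q (\<theta> q) (circ t)\<bar> \<le> B" and h_borel: "h \<in> borel_measurable borel"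
    by (simp_all add: h_def[abs_def])
  have bdd: "bdd_above (range (\<lambda>q. H q (\<theta> q) (circ t)))" for t
    using B by (intro bdd_aboveI2[of _ _ B]) (meson abs_le_D1)
  have h_ge: "H q (\<theta> q) (circ t) \<le> h t" for q t
    unfolding h_def by (intro cSUP_upper bdd) simp
  have h_bound: "\<bar>h t\<bar> \<le> B" for t
  proof -
    have "h t \<le> B"
      unfolding h_def using B by (intro cSUP_least) (auto intro: abs_le_D1)
    moreover have "- B \<le> h t"
      using B[of undefined t] h_ge[of undefined t] by linarith
    ultimately show ?thesis
      by linarith
  qed
  have sets: "sets \<mu> = sets (sigma (topspace (phase_topology A)) {U. openin (phase_topology A) U})"
    and prob: "emeasure \<mu> (space \<mu>) = 1"
    and flow: "\<And>\<tau>. el_flow A L \<tau> \<in> measurable \<mu> \<mu>" "\<And>\<tau>. distr \<mu> \<mu> (el_flow A L \<tau>) = \<mu>"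
    using \<mu> by (auto simp: invariant_measures_def)
  have sub: "{U. openin (phase_topology A) U} \<subseteq> Pow (topspace (phase_topology A))"
    by (auto dest: openin_subset)
  have space: "space \<mu> = tangent_bundle A \<times> UNIV"
    using sets_eq_imp_space_eq[OF sets] sub by (simp add: topspace_phase_topology[OF A])
  interpret finite_measure \<mu>
    by (rule finite_measureI) (simp add: prob)
  define r where "r x = circle_rep (snd x)" for x :: "('m \<times> ('m, 'n) tangent) \<times> circle"
  have r_borel: "r \<in> borel_measurable \<mu>"
  proof -
    \<comment> \<open>The projection to the circle is continuous: it pulls open sets back to open
      sets of phase space, which generate the sets of \<open>\<mu>\<close>.\<close>
    have "snd \<in> measurable \<mu> borel"
    proof (rule borel_measurableI)
      fix U :: "circle set" assume "open U"
      then have "openin (phase_topology A) (topspace (tangent_bundle_topology A) \<times> U)"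
        unfolding phase_topology_def openin_prod_Times_iff by simp
      moreover have "topspace (tangent_bundle_topology A) = tangent_bundle A"
        using topspace_phase_topology[OF A] unfolding phase_topology_def topspace_prod_topology by auto
      moreover have "snd -` U \<inter> space \<mu> = tangent_bundle A \<times> U"
        unfolding space by auto
      ultimately show "snd -` U \<inter> space \<mu> \<in> sets \<mu>"
        unfolding sets using sub by (simp add: sets_measure_of sigma_sets.Basic)
    qed
    from measurable_compose[OF this borel_measurable_circle_rep] show ?thesis
      by (simp add: r_def[abs_def])
  qed
  have avg: "(\<integral>x. h (r x) \<partial>\<mu>) = integral {0..1} h"
  proof (rule integral_invariant_phase[OF finite_measure_axioms _ flow r_borel _ _ h_borel h_bound])
    show "measure \<mu> (space \<mu>) = 1"
      using prob by (simp add: measure_def)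
    show "0 \<le> r x" "r x \<le> 1" for x
      using circle_rep_bounds[of "snd x"] by (simp_all add: r_def)
    show "h (t + 1) = h t" for t
      by (simp add: h_def circ_add)
    \<comment> \<open>By its definition \<open>el_flow\<close> rotates the time component by
      \<open>\<tau>\<close>, whichever orbit is chosen, and \<open>h\<close> sees a phase only
      through \<open>circ\<close>.\<close>
    show "h (r (el_flow A L \<tau> x)) = h (r x + \<tau>)" for \<tau> x
      by (simp add: h_def r_def el_flow_def Let_def flip: rotate_circle_circ)
  qed
  have int_h: "integrable \<mu> (\<lambda>x. h (r x))"
    using h_bound measurable_compose[OF r_borel h_borel] by (intro integrable_const_bound[of _ B]) auto
  have "(\<integral>((q, v), s). \<theta> q v \<partial>\<mu>) - integral {0..1} h =
      (\<integral>x. (\<lambda>((q, v), s). \<theta> q v) x - h (r x) \<partial>\<mu>)"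
    by (simp only: Bochner_Integration.integral_diff[OF integrable_closed_1form[OF A \<mu> \<theta>] int_h] avg)
  also have "\<dots> \<le> (\<integral>((q, v), s). legendre A H q v s \<partial>\<mu>)"
  proof (rule integral_mono[OF Bochner_Integration.integrable_diff[OF integrable_closed_1form[OF A \<mu> \<theta>] int_h]
        integrable_legendre[OF \<mu>]])
    fix x assume x: "x \<in> space \<mu>"
    obtain q v s where x_eq: "x = ((q, v), s)"
      by (cases x) auto
    have "v \<in> tangent_space A q"
      using x by (simp add: space x_eq tangent_bundle_def)
    from fenchel_inequality[OF \<theta> this, of "circle_rep s"] h_ge[of q "circle_rep s"]
    show "(\<lambda>((q, v), s). \<theta> q v) x - h (r x) \<le> (\<lambda>((q, v), s). legendre A H q v s) x"
      by (simp add: x_eq r_def)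
  qed
  finally show ?thesis
    by (simp only: h_def[abs_def])
qed

end

section \<open>The zero homology class and the passage to the infima\<close>

lemma closed_1form_zero: "closed_1form A (\<lambda>q v. 0)"
proof -
  have "form_coord A c (\<lambda>q v. 0) = (\<lambda>x. 0)" for c
    by (simp add: form_coord_def fun_eq_iff vec_eq_iff)
  then show ?thesis
    by (simp add: closed_1form_def cotangent_space_def smooth_on_zero)
qed

lemma zero_in_zero_homology_class: "0 \<in> zero_homology_class p X"
proof -
  have "real_cycle p X 0"
    by (simp add: real_cycle_def real_singular_chain_def real_boundary_def)
  moreover have "real_singular_chain (Suc p) X 0" "real_boundary (Suc p) 0 = 0 - (0 :: 'a real_chain)"
    by (simp_all add: real_singular_chain_def real_boundary_def)
  ultimately show ?thesis
    unfolding zero_homology_class_def real_homologous_def by blast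
qed

text \<open>The zero class is represented by the zero chain, over which every form integrates to an
  empty sum.\<close>

lemma rotation_vector_zero:
  assumes "has_rotation_vector A \<mu> (zero_homology_class 1 euclidean)" "closed_1form A \<theta>"
  shows "(\<integral>((q, v), s). \<theta> q v \<partial>\<mu>) = 0"
proof -
  have "(\<integral>((q, v), s). \<theta> q v \<partial>\<mu>) = chain_integral A \<theta> 0"
    using assms zero_in_zero_homology_class[of 1 euclidean] unfolding has_rotation_vector_def by metis
  then show ?thesis
    by (simp add: chain_integral_def)
qed

theorem corollary1:
  fixes A :: "('m::t2_space, 'n::finite) chart set"
    and g :: "('m, 'n) metric"
    and H :: "('m, 'n) hamiltonian"
  assumes "smooth_atlas A"
    and "compact (UNIV :: 'm set)"
    and "connected (UNIV :: 'm set)"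
    and "orientable A"
    and "riemannian_metric A g"
    and "\<nexists>\<gamma>. nontrivial_contractible_closed_geodesic A g \<gamma>"
    and "smooth_hamiltonian A H"
    and "fibrewise_convex A H"
    and "fibrewise_superlinear A g H"
    and "complete_el_flow A (legendre A H)"
  shows "- mather_beta A (legendre A H) (zero_homology_class 1 euclidean) \<le> ereal (c_ham A H)"
proof -
  interpret convex_superlinear_hamiltonian A g H
    by unfold_locales (use assms in blast)+
  have "ereal (- c_ham A H) \<le> ereal (\<integral>((q, v), s). legendre A H q v s \<partial>\<mu>)"
    if \<mu>: "\<mu> \<in> invariant_measures A (legendre A H)"
      "has_rotation_vector A \<mu> (zero_homology_class 1 euclidean)" for \<mu>
  proof -
    \<comment> \<open>The sign is moved so that, for fixed \<open>\<mu>\<close>, the left side is a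
      lower bound of the family whose infimum is \<open>c_ham\<close>. As this is an infimum of
      reals, its index set must be nonempty; the zero form shows this.\<close>
    have "- (\<integral>((q, v), s). legendre A H q v s \<partial>\<mu>) \<le> c_ham A H"
      unfolding c_ham_def
    proof (rule cINF_greatest)
      show "{\<theta>. closed_1form A \<theta>} \<noteq> {}"
        using closed_1form_zero by blast
      fix \<theta> assume "\<theta> \<in> {\<theta>. closed_1form A \<theta>}"
      then have \<theta>: "closed_1form A \<theta>"
        by simp
      show "- (\<integral>((q, v), s). legendre A H q v s \<partial>\<mu>) \<le>
          integral {0..1} (\<lambda>t. SUP q. H q (\<theta> q) (circ t))"
        using integral_legendre_ge[OF assms(2) \<mu>(1) \<theta>] rotation_vector_zero[OF \<mu>(2) \<theta>] by linarith
    qed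
    then show ?thesis
      by simp
  qed
  \<comment> \<open>This infimum is taken in the extended reals, where the bound also covers an
    empty set of measures, whose infimum is infinite.\<close>
  then have "ereal (- c_ham A H) \<le> mather_beta A (legendre A H) (zero_homology_class 1 euclidean)"
    unfolding mather_beta_def by (intro INF_greatest) blast
  then show ?thesis
    by (simp add: ereal_uminus_le_reorder)
qed

end
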